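(* Let $T$ be a bounded linear operator on a complex Hilbert space $H$ whose adjoint $T^*$ is an isometry. Then $T$ can be embedded into a $C_0$-semigroup on $H$ if and only if $T$ is injective or $\dim(\ker T)=\infty$.
   Context: A linear operator $T$ on a Banach space $X$ can be embedded into a $C_0$-semigroup (is embeddable) if there exists a $C_0$-semigroup (strongly continuous one-parameter semigroup of bounded linear operators) $(T(t))_{t\ge 0}$ on $X$ such that $T=T(1)$. Here $\dim(\ker T)=\infty$ means that the kernel of $T$ is not finite-dimensional. *)

theory Defs
  imports "HOL-Analysis.Analysis"
begin

text \<open>
  Complex normed spaces and complex Hilbert spaces as type classes. They extend the real classes
  of the library, so that norm, topology, completeness and \<^const>\<open>bounded_linear\<close> are the
  library notions; the real scalar multiplication is tied to the complex one by
  \<open>scaleR_scaleC\<close>.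
\<close>

class scaleC =
  fixes scaleC :: "complex \<Rightarrow> 'a \<Rightarrow> 'a" (infixr \<open>*\<^sub>C\<close> 75)

class complex_vector = real_vector + scaleC +
  assumes scaleC_add_right: "a *\<^sub>C (x + y) = a *\<^sub>C x + a *\<^sub>C y"
    and scaleC_add_left: "(a + b) *\<^sub>C x = a *\<^sub>C x + b *\<^sub>C x"
    and scaleC_scaleC: "a *\<^sub>C (b *\<^sub>C x) = (a * b) *\<^sub>C x"
    and scaleC_one: "1 *\<^sub>C x = x"
    and scaleR_scaleC: "r *\<^sub>R x = complex_of_real r *\<^sub>C x"

global_interpretation complex_vector: vector_space "scaleC :: complex \<Rightarrow> 'a \<Rightarrow> 'a::complex_vector"
  defines cspan = complex_vector.span
  by unfold_locales (simp_all add: scaleC_add_right scaleC_add_left scaleC_scaleC scaleC_one)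

class complex_normed_vector = complex_vector + real_normed_vector +
  assumes norm_scaleC: "norm (a *\<^sub>C x) = cmod a * norm x"

class cbanach = complex_normed_vector + banach

text \<open>
  The inner product is linear in the first and antilinear in the second argument. As
  \<open>\<langle>x, x\<rangle>\<close> is real by \<open>cinner_commute\<close>, the last axiom says that it
  equals \<open>\<parallel>x\<parallel>\<^sup>2\<close>, so positive definiteness is inherited from the norm.
\<close>

class complex_inner = complex_normed_vector +
  fixes cinner :: "'a \<Rightarrow> 'a \<Rightarrow> complex"
  assumes cinner_add_left: "cinner (x + y) z = cinner x z + cinner y z"
    and cinner_scaleC_left: "cinner (a *\<^sub>C x) y = a * cinner x y"
    and cinner_commute: "cinner x y = cnj (cinner y x)"
    and norm_eq_sqrt_cinner: "norm x = sqrt (Re (cinner x x))"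

class chilbert_space = complex_inner + cbanach

definition bounded_clinear ::
    "('a::complex_normed_vector \<Rightarrow> 'b::complex_normed_vector) \<Rightarrow> bool" where
  "bounded_clinear f \<longleftrightarrow> bounded_linear f \<and> (\<forall>c x. f (c *\<^sub>C x) = c *\<^sub>C f x)"

text \<open>
  As for the library's \<^const>\<open>adjoint\<close>, the defining property determines the adjoint uniquely;
  for bounded complex-linear operators on a Hilbert space it exists by the Riesz representation
  theorem.
\<close>

definition cadjoint :: "('a::complex_inner \<Rightarrow> 'b::complex_inner) \<Rightarrow> 'b \<Rightarrow> 'a" where
  "cadjoint T = (SOME S. \<forall>x y. cinner (T x) y = cinner x (S y))"

definition isometry :: "('a::metric_space \<Rightarrow> 'b::metric_space) \<Rightarrow> bool" where
  "isometry S \<longleftrightarrow> (\<forall>x y. dist (S x) (S y) = dist x y)"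

definition finite_cdim :: "'a::complex_vector set \<Rightarrow> bool" where
  "finite_cdim S \<longleftrightarrow> (\<exists>B. finite B \<and> cspan B = S)"

text \<open>Only the values at times \<open>t \<ge> 0\<close> of the family are relevant.\<close>

definition C0_semigroup :: "(real \<Rightarrow> 'a::cbanach \<Rightarrow> 'a) \<Rightarrow> bool" where
  "C0_semigroup U \<longleftrightarrow>
     (\<forall>t\<ge>0. bounded_clinear (U t)) \<and>
     U 0 = id \<and>
     (\<forall>s\<ge>0. \<forall>t\<ge>0. U (s + t) = U s \<circ> U t) \<and>
     (\<forall>x. continuous_on {0..} (\<lambda>t. U t x))"

definition embeddable :: "('a::cbanach \<Rightarrow> 'a) \<Rightarrow> bool" where
  "embeddable T \<longleftrightarrow> (\<exists>U. C0_semigroup U \<and> T = U 1)"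

end

theory Submission
  imports Defs
begin

text \<open>
  The adjoint \<open>S = T*\<close> is an isometry with \<open>T S = 1\<close>. If \<open>T\<close> embeds and \<open>T x = 0\<close> with \<open>x \<noteq> 0\<close>, the
  orbit of \<open>x\<close> before its first zero is a linearly independent subset of the kernel. Conversely it
  suffices to embed \<open>S\<close> into a semigroup of isometries and to pass to adjoints. By the Wold
  decomposition \<open>S\<close> is the sum of a unitary operator, whose powers are defined by binomial series,
  and a shift of multiplicity \<open>dim (ker T)\<close>. If this is an infinite cardinal, it is unchanged by
  multiplication with \<open>\<aleph>\<^sub>0\<close>, so that \<open>ker T\<close> can be identified with a sum of copies of \<open>L\<^sup>2[0,1]\<close>
  by means of the Haar basis, and \<open>S\<close> with the translation by \<open>1\<close> on copies of \<open>L\<^sup>2[0,\<infinity>)\<close>.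
\<close>

section \<open>Complex inner product spaces\<close>

text \<open>No function space and no spectral theorem enters. An isometry is obtained from
  prescribed values on a total set as soon as values and arguments have the same inner products, so
  each part of \<open>S\<close> only has to supply vectors whose inner products can be computed. On
  the unitary part the obstacle is that the principal power of \<open>z\<close> jumps at
  \<open>z = -1\<close>, so it is no uniform limit of polynomials in \<open>z\<close> and
  \<open>1/z\<close> on the circle. Multiplied by a factor that vanishes at \<open>-1\<close> it
  becomes a product of two binomial series with exponents at least 1, whose coefficients are
  absolutely summable; eigenvectors for \<open>-1\<close> are treated apart. On the shift part,
  \<open>ker T\<close> is seen only through an orthonormal basis. Every translation model needs a
  whole \<open>L^2[0,1]\<close>, which is infinite-dimensional, so one basis vector has to be traded
  for countably many. The isometries are built for \<open>S\<close> and not for \<open>T\<close>,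
  because a contraction is not controlled by inner products on a total set.\<close>

lemma cinner_add_right: "cinner x (y + z) = cinner x y + cinner x (z::'a::complex_inner)"
  unfolding cinner_commute[of x] by (simp add: cinner_add_left)

lemma cinner_scaleC_right: "cinner x (a *\<^sub>C y) = cnj a * cinner x (y::'a::complex_inner)"
  unfolding cinner_commute[of x] by (simp add: cinner_scaleC_left)

lemma cinner_zero [simp]: "cinner 0 y = 0" "cinner y (0::'a::complex_inner) = 0"
  using cinner_add_left[of 0 0 y] cinner_add_right[of y 0 0] by simp_all

lemma cinner_minus [simp]:
  "cinner (- x) y = - cinner x y" "cinner x (- y) = - cinner x (y::'a::complex_inner)"
  using cinner_add_left[of x "- x" y] cinner_add_right[of x y "- y"]
  by (simp_all add: eq_neg_iff_add_eq_0 add.commute)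

lemma cinner_diff:
  "cinner (x - z) y = cinner x y - cinner z y"
  "cinner y (x - z) = cinner y x - cinner y (z::'a::complex_inner)"
  using cinner_add_left[of x "- z" y] cinner_add_right[of y x "- z"] by simp_all

lemmas cinner_simps = cinner_add_left cinner_add_right cinner_diff
  cinner_scaleC_left cinner_scaleC_right

lemma cinner_self: "cinner x x = complex_of_real ((norm (x::'a::complex_inner))\<^sup>2)"
proof -
  have "Im (cinner x x) = 0"
    using arg_cong[OF cinner_commute[of x x], of Im] by simp
  moreover have "Re (cinner x x) \<ge> 0"
    using norm_ge_zero[of x] by (simp add: norm_eq_sqrt_cinner)
  ultimately show ?thesis
    by (simp add: complex_eq_iff norm_eq_sqrt_cinner)
qed

lemma norm_add_sq: "(norm (x + y))\<^sup>2 = (norm x)\<^sup>2 + (norm y)\<^sup>2 + 2 * Re (cinner x (y::'a::complex_inner))"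
proof -
  have "Re (cinner (x + y) (x + y)) = Re (cinner x x) + Re (cinner y y) + 2 * Re (cinner x y)"
    using arg_cong[OF cinner_commute[of y x], of Re] by (simp add: cinner_simps)
  then show ?thesis by (simp add: cinner_self)
qed

lemma norm_diff_sq: "(norm (x - y))\<^sup>2 = (norm x)\<^sup>2 + (norm y)\<^sup>2 - 2 * Re (cinner x (y::'a::complex_inner))"
  using norm_add_sq[of x "-y"] by simp

text \<open>Pythagoras for the component of \<open>x\<close> along \<open>y\<close>. It serves
  twice: nonnegativity of the left side is Cauchy-Schwarz, and the loss on the right side forces
  orthogonality at a nearest point.\<close>

lemma norm_diff_proj_sq:
  assumes "y \<noteq> (0::'a::complex_inner)"
  shows "(norm (x - (cinner x y / complex_of_real ((norm y)\<^sup>2)) *\<^sub>C y))\<^sup>2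
    = (norm x)\<^sup>2 - (cmod (cinner x y))\<^sup>2 / (norm y)\<^sup>2"
proof -
  define c where "c = cinner x y / complex_of_real ((norm y)\<^sup>2)"
  have n: "norm y \<noteq> 0" using assms by simp
  have "cinner x (c *\<^sub>C y) = cnj (cinner x y) * cinner x y / complex_of_real ((norm y)\<^sup>2)"
    by (simp add: cinner_scaleC_right c_def)
  also have "\<dots> = complex_of_real ((cmod (cinner x y))\<^sup>2 / (norm y)\<^sup>2)"
    by (simp add: complex_norm_square mult.commute flip: of_real_power)
  finally have 1: "Re (cinner x (c *\<^sub>C y)) = (cmod (cinner x y))\<^sup>2 / (norm y)\<^sup>2"
    by (metis Re_complex_of_real)
  have "(norm (c *\<^sub>C y))\<^sup>2 = (cmod (cinner x y))\<^sup>2 / (norm y)\<^sup>2"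
    using n by (simp add: norm_scaleC c_def norm_divide norm_mult power_mult_distrib power_divide
        power2_eq_square)
  with 1 show ?thesis unfolding c_def[symmetric] norm_diff_sq by simp
qed

lemma cinner_Cauchy_Schwarz: "cmod (cinner x y) \<le> norm x * norm (y::'a::complex_inner)"
proof (cases "y = 0")
  case False
  have "(cmod (cinner x y))\<^sup>2 / (norm y)\<^sup>2 \<le> (norm x)\<^sup>2"
    using norm_diff_proj_sq[OF False, of x] zero_le_power2 diff_ge_0_iff_ge by metis
  then have "(cmod (cinner x y))\<^sup>2 \<le> (norm x * norm y)\<^sup>2"
    using False by (simp add: divide_le_eq power_mult_distrib)
  then show ?thesis by (meson mult_nonneg_nonneg norm_ge_zero power2_le_imp_le)
qed simp

lemma bounded_bilinear_cinner: "bounded_bilinear (cinner :: 'a::complex_inner \<Rightarrow> _)"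
proof
  fix r :: real and a b :: 'a
  show "cinner (r *\<^sub>R a) b = r *\<^sub>R cinner a b"
    by (simp add: scaleR_scaleC cinner_scaleC_left scaleR_conv_of_real)
  show "cinner a (r *\<^sub>R b) = r *\<^sub>R cinner a b"
    by (simp add: scaleR_scaleC cinner_scaleC_right scaleR_conv_of_real)
  show "\<exists>K. \<forall>a b::'a. cmod (cinner a b) \<le> norm a * norm b * K"
    by (intro exI[of _ 1]) (simp add: cinner_Cauchy_Schwarz)
qed (simp_all add: cinner_simps)

lemmas tendsto_cinner = bounded_bilinear.tendsto[OF bounded_bilinear_cinner]
lemmas continuous_on_cinner = bounded_bilinear.continuous_on[OF bounded_bilinear_cinner]
lemmas cinner_sums_left = bounded_linear.sums[OF bounded_bilinear.bounded_linear_left[OF bounded_bilinear_cinner]]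
lemmas cinner_sums_right = bounded_linear.sums[OF bounded_bilinear.bounded_linear_right[OF bounded_bilinear_cinner]]

lemma cinner_eq_0_iff: "cinner x x = 0 \<longleftrightarrow> x = (0::'a::complex_inner)"
  by (simp add: cinner_self)

lemma cinner_eq_0_commute: "cinner x y = 0 \<longleftrightarrow> cinner y (x::'a::complex_inner) = 0"
  using cinner_commute[of x y] by simp

lemma cinner_eqI:
  assumes "\<And>z. cinner x z = cinner y z"
  shows "x = (y::'a::complex_inner)"
proof -
  have "cinner (x - y) (x - y) = 0" unfolding cinner_diff(1) by (simp add: assms)
  then show ?thesis by (simp add: cinner_eq_0_iff)
qed

lemma cinner_eqI':
  assumes "\<And>z. cinner z x = cinner z y"
  shows "x = (y::'a::complex_inner)"
proof (rule cinner_eqI)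
  fix z show "cinner x z = cinner y z"
    using assms[of z] cinner_commute[of x z] cinner_commute[of y z] by simp
qed

section \<open>Orthogonal projection and density by orthogonality\<close>

abbreviation csubspace :: "'a::complex_vector set \<Rightarrow> bool" where
  "csubspace \<equiv> complex_vector.subspace"

text \<open>A minimising sequence is Cauchy: midpoints stay in \<open>M\<close>, so the
  parallelogram law bounds the squared distance of two terms by twice the sum of their excesses over
  the infimum \<open>d\<close> of the squared distances.\<close>

lemma nearest_point_exists:
  fixes M :: "'a::chilbert_space set"
  assumes cl: "closed M" and sub: "csubspace M"
  shows "\<exists>p\<in>M. \<forall>m\<in>M. norm (x - p) \<le> norm (x - m)"
proof -
  define d where "d = (INF m\<in>M. (norm (x - m))\<^sup>2)"
  have M0: "0 \<in> M" using sub complex_vector.subspace_0 by blast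
  have bdd: "bdd_below ((\<lambda>m. (norm (x - m))\<^sup>2) ` M)"
    by (intro bdd_belowI[of _ 0]) auto
  have d: "d \<le> (norm (x - m))\<^sup>2" if "m \<in> M" for m
    unfolding d_def using bdd that by (rule cINF_lower)
  have "\<exists>m\<in>M. (norm (x - m))\<^sup>2 < d + 1 / Suc n" for n
    using cINF_less_iff[OF _ bdd, of "d + 1 / Suc n"] M0 d_def by auto
  then obtain m where mM: "\<And>n. m n \<in> M" and m: "\<And>n. (norm (x - m n))\<^sup>2 < d + 1 / Suc n"
    by metis
  have mid: "(norm (m i - m j))\<^sup>2 \<le> 2 / Suc i + 2 / Suc j" for i j
  proof -
    define u v where "u = x - m i" and "v = x - m j"
    have "(1/2) *\<^sub>C (m i + m j) \<in> M"
      using mM sub by (metis complex_vector.subspace_add complex_vector.subspace_scale)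
    then have "d \<le> (norm (x - (1/2) *\<^sub>C (m i + m j)))\<^sup>2" by (rule d)
    also have "x - (1/2) *\<^sub>C (m i + m j) = (1/2) *\<^sub>C (u + v)"
    proof -
      have "(1/2) *\<^sub>C x + (1/2) *\<^sub>C x = x" by (simp add: scaleC_one flip: scaleC_add_left)
      then show ?thesis
        by (simp add: u_def v_def complex_vector.scale_right_diff_distrib scaleC_add_right algebra_simps)
    qed
    also have "(norm \<dots>)\<^sup>2 = (norm (u + v))\<^sup>2 / 4"
      by (simp add: norm_scaleC power_mult_distrib power_divide norm_divide)
    finally have "4 * d \<le> (norm (u + v))\<^sup>2" by simp
    moreover have "(norm (u + v))\<^sup>2 + (norm (v - u))\<^sup>2 = 2 * (norm u)\<^sup>2 + 2 * (norm v)\<^sup>2"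
      using norm_add_sq[of u v] norm_diff_sq[of u v] norm_minus_commute[of u v] by simp
    moreover have "v - u = m i - m j" by (simp add: u_def v_def)
    ultimately show ?thesis using m[of i] m[of j] by (simp add: u_def v_def)
  qed
  have "Cauchy m"
  proof (rule metric_CauchyI)
    fix e :: real assume e: "0 < e"
    obtain N :: nat where N: "4 / e\<^sup>2 < N" using reals_Archimedean2 by blast
    show "\<exists>N. \<forall>i\<ge>N. \<forall>j\<ge>N. dist (m i) (m j) < e"
    proof (intro exI[of _ N] allI impI)
      fix i j assume ij: "N \<le> i" "N \<le> j"
      have N0: "0 < real (Suc N)" by simp
      have "2 / Suc i \<le> 2 / Suc N" "2 / Suc j \<le> 2 / Suc N"
        using ij by (simp_all add: frac_le)
      then have "(norm (m i - m j))\<^sup>2 \<le> 4 / Suc N" using mid[of i j] by simp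
      also have "\<dots> < e\<^sup>2"
      proof -
        have "4 < real N * e\<^sup>2" using N e by (simp add: divide_less_eq)
        also have "\<dots> \<le> real (Suc N) * e\<^sup>2" by (simp add: mult_right_mono)
        finally show ?thesis by (simp add: divide_less_eq mult.commute)
      qed
      finally show "dist (m i) (m j) < e" using e by (simp add: dist_norm power_less_imp_less_base)
    qed
  qed
  then obtain p where p: "m \<longlonglongrightarrow> p" using Cauchy_convergent convergent_def by blast
  have pM: "p \<in> M" using cl mM p closed_sequentially by blast
  have lim1: "(\<lambda>n. (norm (x - m n))\<^sup>2) \<longlonglongrightarrow> (norm (x - p))\<^sup>2"
    by (intro tendsto_intros p)
  have lim2: "(\<lambda>n. d + 1 / Suc n) \<longlonglongrightarrow> d + 0"
    by (intro tendsto_add tendsto_const) (use LIMSEQ_inverse_real_of_nat in \<open>simp add: inverse_eq_divide\<close>)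
  have "(norm (x - p))\<^sup>2 \<le> d + 0"
  proof (rule LIMSEQ_le[OF lim1 lim2])
    have "(norm (x - m n))\<^sup>2 \<le> d + 1 / Suc n" for n using m[of n] by (rule less_imp_le)
    then show "\<exists>N. \<forall>n\<ge>N. (norm (x - m n))\<^sup>2 \<le> d + 1 / Suc n" by blast
  qed
  then have "norm (x - p) \<le> norm (x - k)" if "k \<in> M" for k
    using order_trans[OF _ d[OF that], of "(norm (x - p))\<^sup>2"] power2_le_imp_le[of "norm (x - p)" "norm (x - k)"] by simp
  then show ?thesis using pM by blast
qed

text \<open>If \<open>x - p\<close> had a component along some \<open>m\<close> in \<open>M\<close>,
  moving \<open>p\<close> by that component would come closer to \<open>x\<close>.\<close>

lemma orthogonal_projection_exists:
  fixes M :: "'a::chilbert_space set"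
  assumes cl: "closed M" and sub: "csubspace M"
  shows "\<exists>p\<in>M. \<forall>m\<in>M. cinner (x - p) m = 0"
proof -
  obtain p where p: "p \<in> M" "\<And>m. m \<in> M \<Longrightarrow> norm (x - p) \<le> norm (x - m)"
    using nearest_point_exists[OF assms] by blast
  have "cinner (x - p) m = 0" if m: "m \<in> M" for m
  proof (cases "m = 0")
    case False
    define c where "c = cinner (x - p) m / complex_of_real ((norm m)\<^sup>2)"
    have "p + c *\<^sub>C m \<in> M"
      using p(1) m sub by (metis complex_vector.subspace_add complex_vector.subspace_scale)
    then have "norm (x - p) \<le> norm (x - p - c *\<^sub>C m)" using p(2) by (metis diff_diff_add)
    then have "(norm (x - p))\<^sup>2 \<le> (norm (x - p - c *\<^sub>C m))\<^sup>2" by (simp add: power_mono)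
    then have "(cmod (cinner (x - p) m))\<^sup>2 / (norm m)\<^sup>2 \<le> 0"
      unfolding c_def norm_diff_proj_sq[OF False] by simp
    then show ?thesis using False by (simp add: divide_le_0_iff)
  qed simp
  then show ?thesis using p(1) by blast
qed

text \<open>The induction principle for all later density arguments: a closed linear property has to
  be checked on \<open>A\<close> only. The part of \<open>x\<close> orthogonal to
  \<open>M \<inter> X\<close> lies in \<open>M\<close> and is orthogonal to \<open>A\<close>, hence
  is zero.\<close>

lemma total_set_induct:
  fixes M :: "'a::chilbert_space set"
  assumes "closed M" "csubspace M" "A \<subseteq> M"
    and total: "\<And>x. x \<in> M \<Longrightarrow> (\<And>a. a \<in> A \<Longrightarrow> cinner x a = 0) \<Longrightarrow> x = 0"
    and "closed X" "csubspace X" "A \<subseteq> X"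
  shows "M \<subseteq> X"
proof
  fix x assume x: "x \<in> M"
  have "closed (M \<inter> X)" "csubspace (M \<inter> X)"
    using assms by (auto intro: complex_vector.subspace_inter)
  then obtain p where p: "p \<in> M \<inter> X" "\<And>m. m \<in> M \<inter> X \<Longrightarrow> cinner (x - p) m = 0"
    using orthogonal_projection_exists by blast
  have "x - p \<in> M" using x p(1) assms(2) by (simp add: complex_vector.subspace_diff)
  then have "x - p = 0" using total p(2) assms by blast
  then show "x \<in> X" using p(1) by simp
qed

section \<open>Bounded complex-linear maps, Riesz representation and adjoints\<close>

lemma bounded_clinear_scaleC: "bounded_clinear f \<Longrightarrow> f (c *\<^sub>C x) = c *\<^sub>C f x"
  and bounded_clinear_imp: "bounded_clinear f \<Longrightarrow> bounded_linear f"
  by (auto simp: bounded_clinear_def)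

lemma bounded_clinear_add: "bounded_clinear f \<Longrightarrow> f (x + y) = f x + f y"
  and bounded_clinear_diff: "bounded_clinear f \<Longrightarrow> f (x - y) = f x - f y"
  and bounded_clinear_minus: "bounded_clinear f \<Longrightarrow> f (- x) = - f x"
  and bounded_clinear_zero: "bounded_clinear f \<Longrightarrow> f 0 = 0"
  by (simp_all add: bounded_clinear_imp bounded_linear.linear linear_add linear_diff linear_neg linear_0)

lemmas bounded_clinear_simps = bounded_clinear_add bounded_clinear_diff bounded_clinear_minus
  bounded_clinear_zero bounded_clinear_scaleC

lemma bounded_clinear_continuous_on: "bounded_clinear f \<Longrightarrow> continuous_on A f"
  using bounded_clinear_imp bounded_linear.linear linear_continuous_on by blast

lemma bounded_clinear_compose: "bounded_clinear f \<Longrightarrow> bounded_clinear g \<Longrightarrow> bounded_clinear (f \<circ> g)"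
  by (auto simp: bounded_clinear_def bounded_linear_compose o_def)

lemma bounded_clinear_id: "bounded_clinear id"
  by (auto simp: bounded_clinear_def id_def)

lemma bounded_clinear_funpow:
  "bounded_clinear f \<Longrightarrow> bounded_clinear ((f::'a::complex_normed_vector \<Rightarrow> 'a) ^^ n)"
  by (induction n) (simp_all add: bounded_clinear_id bounded_clinear_compose)

lemma equalizer_closed_csubspace:
  assumes "bounded_clinear f" "bounded_clinear g"
  shows "closed {x. f x = g x}" "csubspace {x. f x = g x}"
proof -
  show "closed {x. f x = g x}"
    using assms by (intro closed_Collect_eq bounded_clinear_continuous_on)
  show "csubspace {x. f x = g x}"
    using assms by (intro complex_vector.subspaceI) (simp_all add: bounded_clinear_simps)
qed

lemma orthogonal_closed_csubspace:
  fixes y :: "'a::complex_inner"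
  shows "closed {x. cinner x y = 0}" "csubspace {x. cinner x y = 0}"
  by (intro closed_Collect_eq continuous_on_cinner continuous_intros)
     (intro complex_vector.subspaceI; simp add: cinner_simps)

lemma Riesz_representation:
  fixes f :: "'a::chilbert_space \<Rightarrow> complex"
  assumes f: "bounded_linear f" and fC: "\<And>c x. f (c *\<^sub>C x) = c * f x"
  shows "\<exists>y. \<forall>x. f x = cinner x y"
proof (cases "\<forall>x. f x = 0")
  case True
  then show ?thesis by (intro exI[of _ 0]) simp
next
  case False
  then obtain x0 where x0: "f x0 \<noteq> 0" by blast
  note lin = linear_add[OF bounded_linear.linear[OF f]] linear_diff[OF bounded_linear.linear[OF f]]
    linear_0[OF bounded_linear.linear[OF f]]
  have "closed {x. f x = 0}"
    by (intro closed_Collect_eq continuous_intros linear_continuous_on f)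
  moreover have "csubspace {x. f x = 0}"
    by (intro complex_vector.subspaceI) (simp_all add: lin fC)
  ultimately obtain p where p: "f p = 0" "\<And>m. f m = 0 \<Longrightarrow> cinner (x0 - p) m = 0"
    using orthogonal_projection_exists[of "{x. f x = 0}" x0] by auto
  define z where "z = x0 - p"
  have fz: "f z \<noteq> 0" using x0 p(1) by (simp add: z_def lin)
  then have z0: "z \<noteq> 0" by (auto simp: lin)
  define y where "y = (cnj (f z) / complex_of_real ((norm z)\<^sup>2)) *\<^sub>C z"
  have "f x = cinner x y" for x
  proof -
    \<comment> \<open>This combination lies in the kernel of \<open>f\<close>, to which
      \<open>z\<close> is orthogonal; solving the resulting equation for \<open>f x\<close> yields
      \<open>y\<close>.\<close>
    have "f (f z *\<^sub>C x - f x *\<^sub>C z) = 0" by (simp add: lin fC)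
    then have "cinner z (f z *\<^sub>C x - f x *\<^sub>C z) = 0" using p(2) z_def by blast
    then have "cinner (f z *\<^sub>C x - f x *\<^sub>C z) z = 0" using cinner_eq_0_commute by blast
    then have "f z * cinner x z = f x * complex_of_real ((norm z)\<^sup>2)"
      by (simp add: cinner_simps cinner_self)
    then show ?thesis using z0 by (simp add: y_def cinner_simps field_simps)
  qed
  then show ?thesis by blast
qed

lemma adjoint_exists:
  fixes T :: "'a::chilbert_space \<Rightarrow> 'b::complex_inner"
  assumes "bounded_clinear T"
  shows "\<exists>S. \<forall>x y. cinner (T x) y = cinner x (S y)"
proof -
  have "\<exists>z. \<forall>x. cinner (T x) y = cinner x z" for y
  proof (rule Riesz_representation)
    show "bounded_linear (\<lambda>x. cinner (T x) y)"
      using assms bounded_clinear_imp bounded_linear_compose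
        bounded_bilinear.bounded_linear_left[OF bounded_bilinear_cinner] by blast
  qed (use assms in \<open>simp add: bounded_clinear_simps cinner_simps\<close>)
  then show ?thesis by metis
qed

lemma adjoint_bounded_clinear:
  fixes T :: "'a::complex_inner \<Rightarrow> 'b::complex_inner"
  assumes T: "bounded_linear T" and adj: "\<And>x y. cinner (T x) y = cinner x (S y)"
  shows "bounded_clinear S"
proof -
  obtain K where K: "\<And>x. norm (T x) \<le> norm x * K" "K > 0" using T bounded_linear.pos_bounded by blast
  have add: "S (x + y) = S x + S y" for x y
    by (rule cinner_eqI') (simp add: cinner_simps flip: adj)
  have C: "S (c *\<^sub>C x) = c *\<^sub>C S x" for c x
    by (rule cinner_eqI') (simp add: cinner_simps flip: adj)
  have "norm (S y) \<le> norm y * K" for y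
  proof (cases "S y = 0")
    case False
    have "(norm (S y))\<^sup>2 = cmod (cinner (S y) (S y))" by (simp add: cinner_self norm_power)
    also have "\<dots> = cmod (cinner (T (S y)) y)" by (simp add: adj)
    also have "\<dots> \<le> norm (S y) * K * norm y"
      using cinner_Cauchy_Schwarz[of "T (S y)" y] mult_right_mono[OF K(1) norm_ge_zero]
      by (meson order_trans)
    finally show ?thesis using False by (simp add: power2_eq_square mult.commute)
  qed (use K(2) in simp)
  then have "bounded_linear S"
    by (intro bounded_linear_intro[of _ K]) (simp_all add: add C scaleR_scaleC)
  with C show ?thesis by (simp add: bounded_clinear_def)
qed

text \<open>Polarisation: norms of sums determine real parts, and replacing \<open>y\<close> by
  \<open>\<i>\<close> times \<open>y\<close> turns imaginary parts into real ones.\<close>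

lemma norm_preserving_imp_cinner:
  fixes S :: "'a::complex_inner \<Rightarrow> 'b::complex_inner"
  assumes S: "bounded_clinear S" and iso: "\<And>x. norm (S x) = norm x"
  shows "cinner (S x) (S y) = cinner x y"
proof -
  have re: "Re (cinner (S x) (S y)) = Re (cinner x y)" for x y
    using norm_add_sq[of "S x" "S y"] norm_add_sq[of x y] iso S by (simp flip: bounded_clinear_simps)
  have "Im (cinner (S x) (S y)) = Im (cinner x y)"
    using re[of x "\<i> *\<^sub>C y"] S by (simp add: bounded_clinear_simps cinner_simps)
  with re show ?thesis by (simp add: complex_eq_iff)
qed

section \<open>Isometries prescribed on a total set\<close>

lemma bounded_linear_scaleC: "bounded_linear (\<lambda>x::'a::complex_normed_vector. c *\<^sub>C x)"
  by (intro bounded_linear_intro[of _ "cmod c"])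
     (simp_all add: scaleR_scaleC scaleC_scaleC scaleC_add_right norm_scaleC mult.commute)

lemma closure_csubspace:
  fixes M :: "'a::complex_normed_vector set"
  assumes M: "csubspace M"
  shows "csubspace (closure M)"
proof (rule complex_vector.subspaceI)
  show "0 \<in> closure M"
    using M complex_vector.subspace_0 closure_subset by blast
  fix x y c assume "x \<in> closure M"
  then obtain f where f: "\<And>n. f n \<in> M" "f \<longlonglongrightarrow> x" unfolding closure_sequential by blast
  from bounded_linear.tendsto[OF bounded_linear_scaleC f(2)] show "c *\<^sub>C x \<in> closure M"
    using f(1) M unfolding closure_sequential
    by (intro exI[of _ "\<lambda>n. c *\<^sub>C f n"]) (simp add: complex_vector.subspace_scale)
  assume "y \<in> closure M"
  then obtain g where g: "\<And>n. g n \<in> M" "g \<longlonglongrightarrow> y" unfolding closure_sequential by blast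
  from tendsto_add[OF f(2) g(2)] show "x + y \<in> closure M"
    using f(1) g(1) M unfolding closure_sequential
    by (intro exI[of _ "\<lambda>n. f n + g n"]) (simp add: complex_vector.subspace_add)
qed

text \<open>The span of \<open>R\<close> in the product space. \<open>R\<close> need not be the
  graph of a function; that its span is one follows later from equality of inner products.\<close>

inductive_set pair_span :: "('a::complex_vector \<times> 'b::complex_vector) set \<Rightarrow> ('a \<times> 'b) set"
  for R where
  zero: "(0, 0) \<in> pair_span R"
| step: "(x, y) \<in> pair_span R \<Longrightarrow> (a, b) \<in> R \<Longrightarrow> (x + c *\<^sub>C a, y + c *\<^sub>C b) \<in> pair_span R"

lemma pair_span_add:
  assumes "(x', y') \<in> pair_span R" "(x, y) \<in> pair_span R"
  shows "(x + x', y + y') \<in> pair_span R"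
  using assms
proof (induction rule: pair_span.induct)
  case (step u v a b c)
  then show ?case using pair_span.step[of "x + u" "y + v" R a b c] by (simp add: add.assoc)
qed simp

lemma pair_span_scale:
  assumes "(x, y) \<in> pair_span R"
  shows "(k *\<^sub>C x, k *\<^sub>C y) \<in> pair_span R"
  using assms
proof (induction rule: pair_span.induct)
  case zero
  then show ?case using pair_span.zero by simp
next
  case (step u v a b c)
  then show ?case using pair_span.step[of "k *\<^sub>C u" "k *\<^sub>C v" R a b "k * c"]
    by (simp add: scaleC_add_right scaleC_scaleC)
qed

lemma pair_span_base: "(a, b) \<in> R \<Longrightarrow> (a, b) \<in> pair_span R"
  using pair_span.step[OF pair_span.zero, of a b R 1] by (simp add: scaleC_one)

lemma pair_span_cinner:
  fixes R :: "('a::complex_inner \<times> 'b::complex_inner) set"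
  assumes gram: "\<And>a b a' b'. (a, b) \<in> R \<Longrightarrow> (a', b') \<in> R \<Longrightarrow> cinner b b' = cinner a a'"
    and xy: "(x, y) \<in> pair_span R" and uv: "(u, v) \<in> pair_span R"
  shows "cinner y v = cinner x u"
proof -
  have R: "cinner y b = cinner x a" if "(a, b) \<in> R" for a b
    using xy by (induction rule: pair_span.induct) (simp_all add: cinner_simps gram that)
  from uv show ?thesis
    by (induction rule: pair_span.induct) (simp_all add: cinner_simps R)
qed

text \<open>Equal inner products make the span of \<open>R\<close> the graph of an isometric map on
  the span \<open>D\<close> of the first components. Totality makes \<open>D\<close> dense, and
  uniform continuity extends the map.\<close>

lemma isometry_extension:
  fixes R :: "('a::chilbert_space \<times> 'b::chilbert_space) set"
  assumes gram: "\<And>a b a' b'. (a, b) \<in> R \<Longrightarrow> (a', b') \<in> R \<Longrightarrow> cinner b b' = cinner a a'"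
    and total: "\<And>x. (\<And>a b. (a, b) \<in> R \<Longrightarrow> cinner x a = 0) \<Longrightarrow> x = 0"
  shows "\<exists>V. bounded_clinear V \<and> (\<forall>x y. cinner (V x) (V y) = cinner x y) \<and> (\<forall>(a, b)\<in>R. V a = b)"
proof -
  define D where "D = fst ` pair_span R"
  define f where "f x = (SOME y. (x, y) \<in> pair_span R)" for x
  have f: "(x, f x) \<in> pair_span R" if "x \<in> D" for x
    unfolding f_def by (rule someI_ex) (use that in \<open>auto simp: D_def\<close>)
  have f_cinner: "cinner (f x) (f y) = cinner x y" if "x \<in> D" "y \<in> D" for x y
    using pair_span_cinner[OF gram f f] that by blast
  \<comment> \<open>The case \<open>x = x'\<close> says that the relation is single-valued; this
    identifies \<open>V a\<close> with \<open>b\<close> at the end.\<close>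
  have dist_eq: "dist y y' = dist x x'"
    if "(x, y) \<in> pair_span R" "(x', y') \<in> pair_span R" for x y x' y'
  proof -
    have "(x - x', y - y') \<in> pair_span R"
      using pair_span_add[OF pair_span_scale[OF that(2), of "- 1"] that(1)] by (simp add: scaleC_one)
    from pair_span_cinner[OF gram this this] show ?thesis
      by (simp add: dist_norm norm_eq_sqrt_cinner)
  qed
  have uc: "uniformly_continuous_on D f"
    unfolding uniformly_continuous_on_def using dist_eq[OF f f] by metis
  obtain V where V: "uniformly_continuous_on (closure D) V" "\<And>x. x \<in> D \<Longrightarrow> f x = V x"
    by (rule uniformly_continuous_on_extension_on_closure[OF uc]) blast
  have "csubspace D"
  proof (rule complex_vector.subspaceI)
    show "0 \<in> D" using pair_span.zero by (force simp: D_def)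
  next
    fix x y c assume "x \<in> D"
    then show "c *\<^sub>C x \<in> D" using pair_span_scale[of x _ R c] by (force simp: D_def)
    assume "y \<in> D"
    with \<open>x \<in> D\<close> show "x + y \<in> D" using pair_span_add[of y _ R x] by (force simp: D_def)
  qed
  then have "csubspace (closure D)" by (rule closure_csubspace)
  have "UNIV \<subseteq> closure D"
  proof (rule total_set_induct[where A = "fst ` R"])
    show "x = 0" if "\<And>a. a \<in> fst ` R \<Longrightarrow> cinner x a = 0" for x
      by (rule total) (use that in force)
    show "fst ` R \<subseteq> closure D"
      using closure_subset[of D] pair_span_base[of _ _ R] by (force simp: D_def image_iff)
  qed (use \<open>csubspace (closure D)\<close> in auto)
  then have clD: "closure D = UNIV" by blast
  then have contV: "continuous_on UNIV V" using V(1) uniformly_continuous_imp_continuous by metis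
  note ci = continuous_on_cinner continuous_on_const continuous_on_id contV
  have "closed {x. cinner (V x) (V y) = cinner x y}" "closed {x. cinner (V y) (V x) = cinner y x}" for y
    by (intro closed_Collect_eq ci)+
  note cl = this
  have 1: "cinner (V x) (V y) = cinner x y" if "y \<in> D" for x y
    using closure_minimal[OF _ cl(1)[of y], of D] f_cinner that clD V(2) by auto
  have 2: "cinner (V x) (V y) = cinner x y" for x y
    using closure_minimal[OF _ cl(2)[of x], of D] 1 clD by auto
  have add: "V (x + y) = V x + V y" for x y
  proof -
    \<comment> \<open>Expanded, this consists of inner products of values of \<open>V\<close>, hence
      equals the same expression without \<open>V\<close>, which is zero. So linearity comes from
      isometry.\<close>
    have "cinner (V (x + y) - (V x + V y)) (V (x + y) - (V x + V y)) = 0"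
      by (simp only: cinner_simps 2) simp
    then show ?thesis by (simp add: cinner_eq_0_iff)
  qed
  have C: "V (c *\<^sub>C x) = c *\<^sub>C V x" for c x
  proof -
    have "cinner (V (c *\<^sub>C x) - c *\<^sub>C V x) (V (c *\<^sub>C x) - c *\<^sub>C V x) = 0"
      by (simp only: cinner_simps 2) simp
    then show ?thesis by (simp add: cinner_eq_0_iff)
  qed
  have "norm (V x) = norm x" for x by (simp add: norm_eq_sqrt_cinner 2)
  then have "bounded_linear V"
    by (intro bounded_linear_intro[of _ 1]) (simp_all add: add C scaleR_scaleC)
  moreover have "V a = b" if "(a, b) \<in> R" for a b
  proof -
    have "a \<in> D" using pair_span_base[OF that] by (force simp: D_def)
    then have "dist b (f a) = dist a a" using dist_eq[OF pair_span_base[OF that] f] by blast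
    then show ?thesis using V(2)[OF \<open>a \<in> D\<close>] by simp
  qed
  ultimately show ?thesis using C 2 unfolding bounded_clinear_def by blast
qed

section \<open>Binomial series of contractions\<close>

text \<open>The bound is uniform in \<open>r\<close>, which gives both the continuity of
  \<open>(1 + A)^r\<close> in \<open>r\<close> and a norm bound common to all \<open>r\<close> in
  \<open>[1, 2]\<close>.\<close>

lemma gbinomial_abs_bound:
  fixes r :: real
  assumes "1 \<le> r" "r \<le> 2"
  shows "\<bar>r gchoose n\<bar> \<le> 9 * inverse ((real (Suc n))\<^sup>2)"
proof (cases "n < 2")
  case True
  then show ?thesis using assms by (auto simp: less_2_cases_iff power2_eq_square)
next
  case False
  have "\<bar>r gchoose n\<bar> \<le> 2 / (real n * (real n - 1))"
    using False[unfolded not_less]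
  proof (induction n rule: dec_induct)
    case base
    have "r * (r - 1) \<le> 2 * 1" using assms by (intro mult_mono) auto
    then show ?case using assms by (simp add: gbinomial_prod_rev numeral_2_eq_2)
  next
    case (step n)
    have "(real n + 1) * (r gchoose Suc n) = (r - real n) * (r gchoose n)"
      using gbinomial_absorb_comp[of r n] gbinomial_absorption[of n r] by (simp add: add.commute)
    then have "r gchoose Suc n = (r gchoose n) * ((r - real n) / (real n + 1))"
      by (simp add: field_simps)
    then have "\<bar>r gchoose Suc n\<bar> = \<bar>r gchoose n\<bar> * \<bar>(r - real n) / (real n + 1)\<bar>"
      by (simp only: abs_mult)
    \<comment> \<open>Since \<open>1 \<le> r\<close> and \<open>2 \<le> n\<close>, the distance of
      \<open>r\<close> from \<open>n\<close> is at most \<open>n - 1\<close>.\<close>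
    also have "\<dots> \<le> 2 / (real n * (real n - 1)) * ((real n - 1) / (real n + 1))"
      using step assms by (intro mult_mono) (auto simp: divide_right_mono)
    also have "\<dots> = 2 / (real (Suc n) * (real (Suc n) - 1))"
    proof -
      have "real n - 1 \<noteq> 0" using step by simp
      then show ?thesis by (simp add: divide_simps step.hyps) (simp add: algebra_simps)
    qed
    finally show ?case .
  qed
  also have "\<dots> \<le> 9 * inverse ((real (Suc n))\<^sup>2)"
  proof -
    have n: "2 \<le> real n" using False by simp
    \<comment> \<open>The difference of the two sides is \<open>(n - 2) * (7 * n + 1)\<close>.
      Equality at \<open>n = 2\<close> is what fixes the constant 9.\<close>
    then have "2 * (real n + 1)\<^sup>2 \<le> 9 * (real n * (real n - 1))"
      using mult_nonneg_nonneg[of "real n - 2" "7 * real n + 1"]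
      by (simp add: power2_eq_square algebra_simps)
    then show ?thesis using n by (simp add: field_simps)
  qed
  finally show ?thesis .
qed

lemma summable_gbinomial_bound: "summable (\<lambda>n. 9 * inverse ((real (Suc n))\<^sup>2))"
  using inverse_squares_sums by (intro summable_mult) (simp add: sums_iff inverse_eq_divide add.commute)

text \<open>Products of series lead to exponents above 2; Pascal's rule reduces them by 1 until the
  uniform bound applies.\<close>

lemma summable_abs_gbinomial:
  fixes r :: real
  assumes "1 \<le> r"
  shows "summable (\<lambda>n. \<bar>r gchoose n\<bar>)"
proof -
  have "1 \<le> r \<Longrightarrow> r \<le> 2 + real k \<Longrightarrow> summable (\<lambda>n. \<bar>r gchoose n\<bar>)" for k
  proof (induction k arbitrary: r)
    case 0
    then show ?case
      by (intro summable_comparison_test[OF _ summable_gbinomial_bound])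
         (use gbinomial_abs_bound in auto)
  next
    case (Suc k)
    show ?case
    proof (cases "r \<le> 2")
      case True
      then show ?thesis using Suc.IH[of r] Suc.prems by simp
    next
      case False
      then have IH: "summable (\<lambda>n. \<bar>(r - 1) gchoose n\<bar>)" using Suc by simp
      have "summable (\<lambda>n. \<bar>r gchoose Suc n\<bar>)"
      proof (rule summable_comparison_test)
        show "summable (\<lambda>n. \<bar>(r - 1) gchoose n\<bar> + \<bar>(r - 1) gchoose Suc n\<bar>)"
          using IH summable_Suc_iff[of "\<lambda>n. \<bar>(r - 1) gchoose n\<bar>"] by (intro summable_add) auto
        show "\<exists>N. \<forall>n\<ge>N. norm \<bar>r gchoose Suc n\<bar> \<le> \<bar>(r - 1) gchoose n\<bar> + \<bar>(r - 1) gchoose Suc n\<bar>"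
          using gbinomial_Suc_Suc[of "r - 1"] by (simp add: abs_triangle_ineq)
      qed
      then show ?thesis using summable_Suc_iff[of "\<lambda>n. \<bar>r gchoose n\<bar>"] by simp
    qed
  qed
  from this[of "nat \<lceil>r\<rceil>"] show ?thesis using assms real_nat_ceiling_ge[of r] by linarith
qed

text \<open>This is \<open>(1 + A)^r\<close>, meaningful for contractions when
  \<open>1 \<le> r\<close>.\<close>

definition binomial_op :: "('a::cbanach \<Rightarrow> 'a) \<Rightarrow> real \<Rightarrow> 'a \<Rightarrow> 'a" where
  "binomial_op A r x = (\<Sum>n. (r gchoose n) *\<^sub>R (A ^^ n) x)"

locale contraction =
  fixes A :: "'a::cbanach \<Rightarrow> 'a"
  assumes clinear: "bounded_clinear A" and norm_le: "norm (A x) \<le> norm x"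
begin

lemma norm_funpow_le: "norm ((A ^^ n) x) \<le> norm x"
  by (induction n) (auto intro: order_trans[OF norm_le])

lemma summable_norm_binomial:
  assumes "1 \<le> r"
  shows "summable (\<lambda>n. norm ((r gchoose n) *\<^sub>R (A ^^ n) x))"
  by (rule summable_comparison_test[OF _ summable_mult2[OF summable_abs_gbinomial[OF assms], of "norm x"]])
     (simp add: mult_left_mono norm_funpow_le)

lemma binomial_op_sums:
  "1 \<le> r \<Longrightarrow> (\<lambda>n. (r gchoose n) *\<^sub>R (A ^^ n) x) sums binomial_op A r x"
  unfolding binomial_op_def by (rule summable_sums[OF summable_norm_cancel[OF summable_norm_binomial]])

lemma norm_binomial_op_le:
  assumes "1 \<le> r" "r \<le> 2"
  shows "norm (binomial_op A r x) \<le> (\<Sum>n. 9 * inverse ((real (Suc n))\<^sup>2)) * norm x"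
proof -
  have "norm (binomial_op A r x) \<le> (\<Sum>n. norm ((r gchoose n) *\<^sub>R (A ^^ n) x))"
    unfolding binomial_op_def by (rule summable_norm[OF summable_norm_binomial[OF assms(1)]])
  also have "\<dots> \<le> (\<Sum>n. 9 * inverse ((real (Suc n))\<^sup>2) * norm x)"
    using gbinomial_abs_bound[OF assms] norm_funpow_le
    by (intro suminf_le summable_norm_binomial assms summable_mult2 summable_gbinomial_bound)
       (simp add: mult_mono)
  also have "\<dots> = (\<Sum>n. 9 * inverse ((real (Suc n))\<^sup>2)) * norm x"
    by (rule suminf_mult2[OF summable_gbinomial_bound, symmetric])
  finally show ?thesis .
qed

lemma bounded_clinear_binomial_op:
  assumes r: "1 \<le> r"
  shows "bounded_clinear (binomial_op A r)"
proof -
  note s = binomial_op_sums[OF r] and A = bounded_clinear_funpow[OF clinear]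
  have add: "binomial_op A r (x + y) = binomial_op A r x + binomial_op A r y" for x y
    using sums_add[OF s s, of x y] s[of "x + y"] A
    by (simp add: bounded_clinear_simps scaleR_add_right sums_unique2)
  have C: "binomial_op A r (c *\<^sub>C x) = c *\<^sub>C binomial_op A r x" for c x
    using bounded_linear.sums[OF bounded_linear_scaleC s, of c x] s[of "c *\<^sub>C x"] A
    by (simp add: bounded_clinear_simps scaleR_scaleC scaleC_scaleC mult.commute sums_unique2)
  have "norm (binomial_op A r x) \<le> norm x * (\<Sum>n. \<bar>r gchoose n\<bar>)" for x
  proof -
    have "norm (binomial_op A r x) \<le> (\<Sum>n. norm ((r gchoose n) *\<^sub>R (A ^^ n) x))"
      unfolding binomial_op_def by (rule summable_norm[OF summable_norm_binomial[OF assms]])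
    also have "\<dots> \<le> (\<Sum>n. norm x * \<bar>r gchoose n\<bar>)"
      using norm_funpow_le
      by (intro suminf_le summable_norm_binomial assms summable_mult summable_abs_gbinomial)
         (simp add: mult.commute[of "norm x"] mult_left_mono)
    also have "\<dots> = norm x * (\<Sum>n. \<bar>r gchoose n\<bar>)"
      by (rule suminf_mult[OF summable_abs_gbinomial[OF assms]])
    finally show ?thesis .
  qed
  then have "bounded_linear (binomial_op A r)"
    by (intro bounded_linear_intro[of _ "\<Sum>n. \<bar>r gchoose n\<bar>"]) (simp_all add: add C scaleR_scaleC)
  with C show ?thesis by (simp add: bounded_clinear_def)
qed

lemma binomial_op_one: "binomial_op A 1 x = x + A x"
proof -
  have "(\<lambda>n. ((1::real) gchoose n) *\<^sub>R (A ^^ n) x) sums (\<Sum>n<2. ((1::real) gchoose n) *\<^sub>R (A ^^ n) x)"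
  proof (rule sums_finite)
    fix n :: nat assume "n \<notin> {..<2}"
    then show "((1::real) gchoose n) *\<^sub>R (A ^^ n) x = 0"
      using binomial_gbinomial[of 1 n, where ?'a = real] by (simp add: binomial_eq_0)
  qed simp
  then show ?thesis
    using sums_unique2 binomial_op_sums[of 1 x] by (fastforce simp: numeral_2_eq_2)
qed

text \<open>The double series converges absolutely. Summed by rows it is the iterated operator,
  summed along antidiagonals it is \<open>(1 + A)^(r + s)\<close> by Vandermonde's identity.\<close>

lemma binomial_op_binomial_op:
  assumes r: "1 \<le> r" and s: "1 \<le> s"
  shows "binomial_op A r (binomial_op A s x) = binomial_op A (r + s) x"
proof -
  define h where "h = (\<lambda>(i, j). ((r gchoose i) * (s gchoose j)) *\<^sub>R (A ^^ (i + j)) x)"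
  have as: "(\<lambda>n. \<bar>q gchoose n\<bar>) summable_on UNIV" if "1 \<le> q" for q :: real
    using summable_abs_gbinomial[OF that] by (simp add: norm_summable_imp_summable_on)
  define g where "g = (\<lambda>(i, j). (r gchoose i) * ((s gchoose j) * norm x))"
  have "(\<lambda>p. norm (g p)) summable_on UNIV \<times> UNIV"
    unfolding g_def
    by (rule summable_on_SigmaI[where g = "\<lambda>i. \<bar>r gchoose i\<bar> * ((\<Sum>\<^sub>\<infinity>j. \<bar>s gchoose j\<bar>) * norm x)"])
       (auto intro!: has_sum_cmult_right has_sum_cmult_left has_sum_infsum as r s
          summable_on_cmult_left simp: abs_mult)
  then have "(\<lambda>p. norm (h p)) summable_on UNIV \<times> UNIV"
    by (rule summable_on_comparison_test)
       (auto simp: g_def h_def abs_mult mult.assoc intro!: mult_left_mono norm_funpow_le)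
  then have "(\<lambda>p. norm (h p)) summable_on UNIV" by simp
  then obtain y where y: "(h has_sum y) UNIV"
    using abs_summable_summable summable_on_def by blast
  have hs: "((\<lambda>n. (q gchoose n) *\<^sub>R (A ^^ n) z) has_sum binomial_op A q z) UNIV" if "1 \<le> q" for q z
    by (rule norm_summable_imp_has_sum[OF summable_norm_binomial binomial_op_sums]) (rule that)+
  have "((\<lambda>i. (r gchoose i) *\<^sub>R (A ^^ i) (binomial_op A s x)) has_sum y) UNIV"
  proof (rule has_sum_SigmaD)
    show "(h has_sum y) (UNIV \<times> UNIV)" using y by simp
    fix i
    have "((\<lambda>j. (r gchoose i) *\<^sub>R (A ^^ i) ((s gchoose j) *\<^sub>R (A ^^ j) x)) has_sum
        (r gchoose i) *\<^sub>R (A ^^ i) (binomial_op A s x)) UNIV"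
      by (rule has_sum_bounded_linear[OF bounded_linear_scaleR_right
            has_sum_bounded_linear[OF bounded_clinear_imp[OF bounded_clinear_funpow[OF clinear]] hs[OF s]]])
    then show "((\<lambda>j. h (i, j)) has_sum (r gchoose i) *\<^sub>R (A ^^ i) (binomial_op A s x)) UNIV"
      by (simp add: h_def scaleR_scaleC bounded_clinear_simps bounded_clinear_funpow[OF clinear]
          funpow_add scaleC_scaleC)
  qed
  then have 1: "y = binomial_op A r (binomial_op A s x)"
    using hs[OF r] has_sum_unique by blast
  have "((\<lambda>(n, i). h (i, n - i)) has_sum y) (SIGMA n:UNIV. {..n}) = (h has_sum y) UNIV"
    by (rule has_sum_reindex_bij_witness[where i = "\<lambda>(i, j). (i + j, i)" and j = "\<lambda>(n, i). (i, n - i)"])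
       auto
  with y have "((\<lambda>(n, i). h (i, n - i)) has_sum y) (SIGMA n:UNIV. {..n})" by blast
  then have "((\<lambda>n. \<Sum>i\<le>n. h (i, n - i)) has_sum y) UNIV"
    by (rule has_sum_SigmaD) (simp add: has_sum_finite)
  moreover have "(\<Sum>i\<le>n. h (i, n - i)) = ((r + s) gchoose n) *\<^sub>R (A ^^ n) x" for n
    by (simp add: h_def scaleR_left.sum[symmetric] gbinomial_Vandermonde[symmetric] atLeast0AtMost)
  ultimately have "y = binomial_op A (r + s) x"
    using hs[of "r + s" x] has_sum_unique r s by fastforce
  with 1 show ?thesis by simp
qed

lemma continuous_on_binomial_op: "continuous_on {1..2} (\<lambda>r. binomial_op A r x)"
proof (rule uniform_limit_theorem)
  show "uniform_limit {1..2} (\<lambda>N r. \<Sum>n<N. (r gchoose n) *\<^sub>R (A ^^ n) x) (\<lambda>r. binomial_op A r x) sequentially"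
    unfolding binomial_op_def
  proof (rule Weierstrass_m_test)
    show "summable (\<lambda>n. 9 * inverse ((real (Suc n))\<^sup>2) * norm x)"
      by (intro summable_mult2 summable_gbinomial_bound)
    fix n r assume "r \<in> {1..2::real}"
    then show "norm ((r gchoose n) *\<^sub>R (A ^^ n) x) \<le> 9 * inverse ((real (Suc n))\<^sup>2) * norm x"
      using gbinomial_abs_bound[of r n] norm_funpow_le[of n x] by (simp add: mult_mono)
  qed
  show "\<forall>\<^sub>F N in sequentially. continuous_on {1..2} (\<lambda>r. \<Sum>n<N. (r gchoose n) *\<^sub>R (A ^^ n) x)"
    by (intro always_eventually allI) (simp add: gbinomial_prod_rev, intro continuous_intros, simp)
qed simp

lemma binomial_op_commute:
  assumes "1 \<le> r" "bounded_linear B" "\<And>n. B ((A ^^ n) x) = (A ^^ n) (B x)"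
  shows "B (binomial_op A r x) = binomial_op A r (B x)"
  using bounded_linear.sums[OF assms(2) binomial_op_sums[OF assms(1), of x]]
    binomial_op_sums[OF assms(1), of "B x"]
  by (simp add: linear_cmul[OF bounded_linear.linear[OF assms(2)]] assms(3) sums_unique2)

lemma binomial_op_in_closed_csubspace:
  assumes "1 \<le> r" "closed M" "csubspace M" "\<And>n. (A ^^ n) x \<in> M"
  shows "binomial_op A r x \<in> M"
proof -
  have "(\<Sum>n<N. (r gchoose n) *\<^sub>R (A ^^ n) x) \<in> M" for N
    using assms(3,4) by (intro complex_vector.subspace_sum) (simp_all add: scaleR_scaleC complex_vector.subspace_scale)
  then show ?thesis
    using closed_sequentially[OF assms(2) _ binomial_op_sums[OF assms(1), unfolded sums_def]] by simp
qed

end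

lemma cinner_funpow_adjoint:
  fixes A :: "'a::complex_inner \<Rightarrow> 'a"
  assumes "\<And>x y. cinner (A x) y = cinner x (B y)"
  shows "cinner ((A ^^ n) x) y = cinner x ((B ^^ n) y)"
proof (induction n arbitrary: y)
  case (Suc n)
  then show ?case using assms[of "(A ^^ n) x" y] by (simp add: funpow_swap1)
qed simp

lemma binomial_op_adjoint:
  fixes A B :: "'a::chilbert_space \<Rightarrow> 'a"
  assumes "contraction A" "contraction B" and adj: "\<And>x y. cinner (A x) y = cinner x (B y)"
    and r: "1 \<le> r"
  shows "cinner (binomial_op A r x) y = cinner x (binomial_op B r y)"
  using cinner_sums_left[OF contraction.binomial_op_sums[OF assms(1) r], of x y]
    cinner_sums_right[OF contraction.binomial_op_sums[OF assms(2) r], of x y]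
  by (simp add: scaleR_scaleC cinner_simps cinner_funpow_adjoint[OF adj] sums_unique2)

section \<open>The shift on a Haar system\<close>

lemma cinner_scaleR [simp]:
  "cinner (r *\<^sub>R x) y = of_real r * cinner x (y::'a::complex_inner)"
  "cinner x (r *\<^sub>R y) = of_real r * cinner x (y::'a::complex_inner)"
  by (simp_all add: scaleR_scaleC cinner_simps)

lemma cinner_sum:
  "cinner (\<Sum>i\<in>I. g i) y = (\<Sum>i\<in>I. cinner (g i) (y::'a::complex_inner))"
  "cinner y (\<Sum>i\<in>I. g i) = (\<Sum>i\<in>I. cinner y (g i))"
  using linear_sum[OF bounded_linear.linear[OF bounded_bilinear.bounded_linear_left[OF bounded_bilinear_cinner]]]
    linear_sum[OF bounded_linear.linear[OF bounded_bilinear.bounded_linear_right[OF bounded_bilinear_cinner]]]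
  by blast+

locale haar_system =
  fixes f :: "nat \<Rightarrow> 'a::chilbert_space" and e :: "nat \<Rightarrow> nat \<Rightarrow> 'a"
  assumes f_f: "cinner (f k) (f l) = (if k = l then 1 else 0)"
    and e_e: "cinner (e i k) (e j l) = (if i = j \<and> k = l then 1 else 0)"
    and f_e: "cinner (f k) (e j l) = 0"
begin

text \<open>In the model \<open>L\<^sup>2[0,\<infinity>)\<close>, \<open>f k\<close> is the indicator of \<open>[k, k + 1)\<close>, \<open>e j k\<close> is the
  normalised Haar function on \<open>[k / 2\<^sup>j, (k + 1) / 2\<^sup>j)\<close>, \<open>cell j k\<close> is the indicator of that
  interval, and \<open>chi s\<close> is the indicator of \<open>[0, s)\<close>.\<close>

fun cell :: "nat \<Rightarrow> nat \<Rightarrow> 'a" where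
  "cell 0 k = f k"
| "cell (Suc j) k = (1/2) *\<^sub>R (cell j (k div 2)
     + ((if even k then 1 else - 1) * sqrt (1 / 2 ^ j)) *\<^sub>R e j (k div 2))"

definition initial :: "nat \<Rightarrow> nat \<Rightarrow> 'a" where "initial j n = (\<Sum>k<n. cell j k)"

definition chi :: "real \<Rightarrow> 'a" where "chi s = lim (\<lambda>j. initial j (nat \<lfloor>2 ^ j * s\<rfloor>))"

text \<open>A cell of level \<open>j\<close> is a combination of vectors \<open>f\<close> and of
  Haar vectors of levels below \<open>j\<close> only.\<close>

lemma cell_e: "j \<le> i \<Longrightarrow> cinner (cell j k) (e i l) = 0"
  by (induction j arbitrary: k) (simp_all add: f_e e_e cinner_simps)

lemma e_cell: "j \<le> i \<Longrightarrow> cinner (e i l) (cell j k) = 0"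
  using cell_e cinner_eq_0_commute by blast

text \<open>The factor \<open>sqrt (1 / 2 ^ j)\<close> scales the Haar vector to the norm of its
  cell, so half the sum and half the difference of the two are orthogonal, each with half the
  squared norm.\<close>

lemma cell_cell: "cinner (cell j k) (cell j l) = (if k = l then 1 / 2 ^ j else 0)"
proof (induction j arbitrary: k l)
  case (Suc j)
  have sq: "complex_of_real (sqrt (1 / 2 ^ j)) * complex_of_real (sqrt (1 / 2 ^ j)) = 1 / 2 ^ j"
    by (simp flip: of_real_mult)
  have kl: "k = l" if "k div 2 = l div 2" "even k = even l"
    using that by (metis bit_eq_rec)
  show ?case
    using kl by (auto simp: cinner_simps Suc e_e cell_e e_cell sq algebra_simps)
qed (simp add: f_f)

lemma initial_double: "initial (Suc j) (2 * n) = initial j n"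
  by (induction n) (simp_all add: initial_def algebra_simps flip: scaleR_add_left)

lemma initial_pow: "initial (j + i) (2 ^ i * n) = initial j n"
  by (induction i) (simp_all add: initial_double mult.assoc)

lemma cinner_initial_same: "cinner (initial j m) (initial j n) = of_real (min m n / 2 ^ j)"
proof -
  have "cinner (initial j m) (initial j n) = (\<Sum>i<m. if i < n then 1 / 2 ^ j else 0)"
    unfolding initial_def cinner_sum(1) unfolding cinner_sum(2) cell_cell by simp
  also have "\<dots> = (\<Sum>i\<in>{..<m} \<inter> {..<n}. 1 / 2 ^ j)"
    using sum.inter_restrict[of "{..<m}" "\<lambda>_. 1 / 2 ^ j :: complex" "{..<n}"] by simp
  also have "{..<m} \<inter> {..<n} = {..<min m n}" by auto
  finally show ?thesis by (simp flip: of_nat_min)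
qed

text \<open>In the model, \<open>initial j n\<close> is the indicator of
  \<open>[0, n / 2 ^ j)\<close>. Both vectors are refined to the common level \<open>i + j\<close>,
  where the cells are orthogonal.\<close>

lemma cinner_initial:
  "cinner (initial i m) (initial j n) = of_real (min (m / 2 ^ i) (n / 2 ^ j))"
proof -
  have "cinner (initial i m) (initial j n)
      = cinner (initial (i + j) (2 ^ j * m)) (initial (i + j) (2 ^ i * n))"
    using initial_pow[of i j m] initial_pow[of j i n] by (simp add: add.commute)
  also have "\<dots> = of_real (min (2 ^ j * m) (2 ^ i * n) / 2 ^ (i + j))"
    by (simp add: cinner_initial_same of_nat_min)
  also have "min (2 ^ j * m) (2 ^ i * n) / 2 ^ (i + j) = min (m / 2 ^ i) (n / (2::real) ^ j)"
    by (simp add: min_divide_distrib_right power_add of_nat_min)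
  finally show ?thesis .
qed

text \<open>Convergence of dyadic end points thus carries over to the vectors, which is why the
  limit defining \<open>chi\<close> exists.\<close>

lemma norm_initial_diff_sq: "(norm (initial i m - initial j n))\<^sup>2 = \<bar>m / 2 ^ i - n / 2 ^ j\<bar>"
proof -
  have "(norm (initial i m))\<^sup>2 = m / 2 ^ i" for i m
    using cinner_initial[of i m i m] by (simp add: cinner_self)
       (metis (no_types) of_real_eq_iff of_real_divide of_real_of_nat_eq of_real_power of_real_numeral)
  then show ?thesis by (simp add: norm_diff_sq cinner_initial)
qed

lemma dyadic_tendsto:
  assumes "0 \<le> s"
  shows "(\<lambda>j. real (nat \<lfloor>2 ^ j * s\<rfloor>) / 2 ^ j) \<longlonglongrightarrow> s"
proof (rule tendsto_sandwich)
  have fl: "real (nat \<lfloor>2 ^ j * s\<rfloor>) = of_int \<lfloor>2 ^ j * s\<rfloor>" for j using assms by simp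
  have "s - (1 / 2) ^ j \<le> real (nat \<lfloor>2 ^ j * s\<rfloor>) / 2 ^ j" for j
  proof -
    have "(2 ^ j * s - 1) / 2 ^ j \<le> of_int \<lfloor>2 ^ j * s\<rfloor> / 2 ^ j"
      by (intro divide_right_mono) (linarith, simp)
    then show ?thesis unfolding fl by (simp add: diff_divide_distrib power_one_over)
  qed
  then show "\<forall>\<^sub>F j in sequentially. s - (1 / 2) ^ j \<le> real (nat \<lfloor>2 ^ j * s\<rfloor>) / 2 ^ j" by simp
  show "\<forall>\<^sub>F j in sequentially. real (nat \<lfloor>2 ^ j * s\<rfloor>) / 2 ^ j \<le> s"
    unfolding fl by (simp add: field_simps)
  have "(\<lambda>j. s - (1 / 2) ^ j) \<longlonglongrightarrow> s - 0"
    by (intro tendsto_diff tendsto_const LIMSEQ_power_zero) simp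
  then show "(\<lambda>j. s - (1 / 2) ^ j) \<longlonglongrightarrow> s" by simp
qed simp

lemma chi_tendsto:
  assumes "0 \<le> s"
  shows "(\<lambda>j. initial j (nat \<lfloor>2 ^ j * s\<rfloor>)) \<longlonglongrightarrow> chi s"
proof -
  have "Cauchy (\<lambda>j. initial j (nat \<lfloor>2 ^ j * s\<rfloor>))"
  proof (rule metric_CauchyI)
    fix \<epsilon> :: real assume \<epsilon>: "0 < \<epsilon>"
    then have "0 < \<epsilon>\<^sup>2" by simp
    from metric_CauchyD[OF LIMSEQ_imp_Cauchy[OF dyadic_tendsto[OF assms]] this]
    obtain N where N: "\<And>i j. N \<le> i \<Longrightarrow> N \<le> j \<Longrightarrow>
        dist (real (nat \<lfloor>2 ^ i * s\<rfloor>) / 2 ^ i) (real (nat \<lfloor>2 ^ j * s\<rfloor>) / 2 ^ j) < \<epsilon>\<^sup>2"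
      by blast
    have "dist (initial i (nat \<lfloor>2 ^ i * s\<rfloor>)) (initial j (nat \<lfloor>2 ^ j * s\<rfloor>)) < \<epsilon>"
      if "N \<le> i" "N \<le> j" for i j
    proof (rule power_less_imp_less_base[of _ 2])
      show "(dist (initial i (nat \<lfloor>2 ^ i * s\<rfloor>)) (initial j (nat \<lfloor>2 ^ j * s\<rfloor>)))\<^sup>2 < \<epsilon>\<^sup>2"
        using N[OF that] unfolding dist_norm norm_initial_diff_sq real_norm_def .
    qed (use \<epsilon> in simp)
    then show "\<exists>N. \<forall>i\<ge>N. \<forall>j\<ge>N. dist (initial i (nat \<lfloor>2 ^ i * s\<rfloor>)) (initial j (nat \<lfloor>2 ^ j * s\<rfloor>)) < \<epsilon>"
      by blast
  qed
  then show ?thesis unfolding chi_def using Cauchy_convergent convergent_LIMSEQ_iff by blast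
qed

lemma cinner_chi:
  assumes "0 \<le> s" "0 \<le> t"
  shows "cinner (chi s) (chi t) = of_real (min s t)"
proof (rule LIMSEQ_unique)
  show "(\<lambda>j. cinner (initial j (nat \<lfloor>2 ^ j * s\<rfloor>)) (initial j (nat \<lfloor>2 ^ j * t\<rfloor>)))
      \<longlonglongrightarrow> cinner (chi s) (chi t)"
    by (intro tendsto_cinner chi_tendsto assms)
  show "(\<lambda>j. cinner (initial j (nat \<lfloor>2 ^ j * s\<rfloor>)) (initial j (nat \<lfloor>2 ^ j * t\<rfloor>)))
      \<longlonglongrightarrow> of_real (min s t)"
    unfolding cinner_initial by (intro tendsto_of_real tendsto_min dyadic_tendsto assms)
qed

lemma chi_dyadic: "chi (n / 2 ^ j) = initial j n"
proof -
  define s where "s = real n / 2 ^ j"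
  have s: "0 \<le> s" by (simp add: s_def)
  have "(\<lambda>i. (norm (initial i (nat \<lfloor>2 ^ i * s\<rfloor>) - initial j n))\<^sup>2) \<longlonglongrightarrow> (norm (chi s - initial j n))\<^sup>2"
    by (intro tendsto_intros chi_tendsto s)
  moreover have "(\<lambda>i. (norm (initial i (nat \<lfloor>2 ^ i * s\<rfloor>) - initial j n))\<^sup>2) \<longlonglongrightarrow> \<bar>s - s\<bar>"
    unfolding norm_initial_diff_sq s_def[symmetric]
    by (intro tendsto_rabs tendsto_diff tendsto_const dyadic_tendsto s)
  ultimately have "(norm (chi s - initial j n))\<^sup>2 = \<bar>s - s\<bar>" by (rule LIMSEQ_unique)
  then show ?thesis by (simp add: s_def)
qed

text \<open>Both families have the same closed span: cells are differences of \<open>chi\<close> at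
  dyadic points, a Haar vector is a combination of its cell and the left half of that cell, and
  conversely every \<open>chi s\<close> is a limit of sums of cells.\<close>

lemma orthogonal_chi_iff:
  "(\<forall>s\<ge>0. cinner y (chi s) = 0) \<longleftrightarrow> (\<forall>k. cinner y (f k) = 0) \<and> (\<forall>j k. cinner y (e j k) = 0)"
proof (intro iffI conjI allI impI; (elim conjE)?)
  assume y: "\<forall>s\<ge>0. cinner y (chi s) = 0"
  have cell: "cinner y (cell j k) = 0" for j k
  proof -
    have "cell j k = chi (real (Suc k) / 2 ^ j) - chi (real k / 2 ^ j)"
      unfolding chi_dyadic by (simp add: initial_def)
    then show ?thesis using y by (simp add: cinner_diff)
  qed
  show "cinner y (f k) = 0" for k using cell[of 0 k] by simp
  show "cinner y (e j k) = 0" for j k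
    using cell[of "Suc j" "2 * k"] cell[of j k] by (simp add: cinner_simps)
next
  fix s :: real
  assume y: "\<forall>k. cinner y (f k) = 0" "\<forall>j k. cinner y (e j k) = 0" and s: "0 \<le> s"
  have "cinner y (cell j k) = 0" for j k
    by (induction j arbitrary: k) (simp_all add: y cinner_simps)
  then have "(\<lambda>j. cinner y (initial j (nat \<lfloor>2 ^ j * s\<rfloor>))) = (\<lambda>j. 0)"
    by (simp add: initial_def cinner_sum)
  moreover have "(\<lambda>j. cinner y (initial j (nat \<lfloor>2 ^ j * s\<rfloor>))) \<longlonglongrightarrow> cinner y (chi s)"
    by (intro tendsto_cinner chi_tendsto s tendsto_const)
  ultimately show "cinner y (chi s) = 0" by (simp add: LIMSEQ_const_iff)
qed

text \<open>Translation by 1 moves a cell of level \<open>j\<close> by \<open>2 ^ j\<close> places,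
  so \<open>[0, s)\<close> goes to \<open>[1, s + 1)\<close>.\<close>

lemma shift_chi:
  assumes S: "bounded_clinear S" and Sf: "\<And>k. S (f k) = f (Suc k)"
    and Se: "\<And>j k. S (e j k) = e j (k + 2 ^ j)" and s: "0 \<le> s"
  shows "S (chi s) = chi (s + 1) - chi 1"
proof -
  have SR: "S (r *\<^sub>R x) = r *\<^sub>R S x" for r x using S by (simp add: scaleR_scaleC bounded_clinear_simps)
  have cell: "S (cell j k) = cell j (k + 2 ^ j)" for j k
    using S by (induction j arbitrary: k) (simp_all add: Sf Se SR bounded_clinear_simps add.commute)
  have initial: "S (initial j n) = initial j (n + 2 ^ j) - initial j (2 ^ j)" for j n
    using S by (induction n) (simp_all add: initial_def cell bounded_clinear_simps)
  have fl: "nat \<lfloor>2 ^ j * s\<rfloor> + 2 ^ j = nat \<lfloor>2 ^ j * (s + 1)\<rfloor>" for j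
  proof -
    have "2 ^ j * (s + 1) = 2 ^ j * s + real_of_int (2 ^ j)" by (simp add: algebra_simps)
    then have "\<lfloor>2 ^ j * (s + 1)\<rfloor> = \<lfloor>2 ^ j * s\<rfloor> + 2 ^ j" by (simp only: floor_add_int)
    then show ?thesis using s by (simp add: nat_add_distrib nat_power_eq)
  qed
  have fl1: "nat \<lfloor>2 ^ j * (1::real)\<rfloor> = 2 ^ j" for j
    by (metis floor_of_nat mult.right_neutral nat_int of_nat_numeral of_nat_power)
  have "(\<lambda>j. S (initial j (nat \<lfloor>2 ^ j * s\<rfloor>))) \<longlonglongrightarrow> S (chi s)"
    by (rule bounded_linear.tendsto[OF bounded_clinear_imp[OF S] chi_tendsto[OF s]])
  moreover have "(\<lambda>j. S (initial j (nat \<lfloor>2 ^ j * s\<rfloor>))) \<longlonglongrightarrow> chi (s + 1) - chi 1"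
    unfolding initial fl using s chi_tendsto[of 1] unfolding fl1
    by (intro tendsto_diff chi_tendsto) auto
  ultimately show ?thesis by (rule LIMSEQ_unique)
qed

end

section \<open>Isometries and their adjoints\<close>

lemma contraction_adjoint:
  fixes S T :: "'a::complex_inner \<Rightarrow> 'a"
  assumes adj: "\<And>x y. cinner (T x) y = cinner x (S y)" and S: "\<And>x. norm (S x) \<le> norm x"
  shows "norm (T x) \<le> norm x"
proof (cases "T x = 0")
  case False
  have "(norm (T x))\<^sup>2 = cmod (cinner x (S (T x)))"
    by (simp add: cinner_self norm_power flip: adj)
  also have "\<dots> \<le> norm x * norm (T x)"
    using cinner_Cauchy_Schwarz[of x "S (T x)"] mult_left_mono[OF S[of "T x"], of "norm x"] by simp
  finally show ?thesis using False by (simp add: power2_eq_square)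
qed simp

locale isometry_adjoint =
  fixes S T :: "'a::chilbert_space \<Rightarrow> 'a"
  assumes S: "bounded_clinear S" and T: "bounded_clinear T"
    and norm_S: "norm (S x) = norm x"
    and adj: "cinner (T x) y = cinner x (S y)"
begin

lemma adj': "cinner (S x) y = cinner x (T y)"
  using cinner_commute[of "S x" y] cinner_commute[of x "T y"] adj[of y x] by simp

lemma cinner_S: "cinner (S x) (S y) = cinner x y"
  by (rule norm_preserving_imp_cinner[OF S norm_S])

lemma TS: "T (S x) = x"
  by (rule cinner_eqI) (simp add: adj cinner_S)

lemma norm_T_le: "norm (T x) \<le> norm x"
  by (rule contraction_adjoint[OF adj]) (simp add: norm_S)

lemma contraction_S: "contraction S" and contraction_T: "contraction T"
  by (unfold_locales; simp add: S T norm_S norm_T_le)+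

text \<open>The part of the Wold decomposition on which \<open>S\<close> is unitary.\<close>

definition unitary_part :: "'a set" where
  "unitary_part = {x. \<forall>n. (S ^^ n) ((T ^^ n) x) = x}"

lemma closed_unitary_part: "closed unitary_part"
  and csubspace_unitary_part: "csubspace unitary_part"
proof -
  have eq: "unitary_part = (\<Inter>n. {x. ((S ^^ n) \<circ> (T ^^ n)) x = id x})"
    by (auto simp: unitary_part_def)
  have bc: "bounded_clinear ((S ^^ n) \<circ> (T ^^ n))" for n
    by (intro bounded_clinear_compose bounded_clinear_funpow S T)
  note e = equalizer_closed_csubspace[OF bc bounded_clinear_id]
  show "closed unitary_part"
    unfolding eq by (rule closed_INT) (rule ballI, rule e(1))
  have "csubspace (\<Inter> (range (\<lambda>n. {x. ((S ^^ n) \<circ> (T ^^ n)) x = id x})))"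
    by (rule complex_vector.subspace_Inter) (use e(2) in blast)
  then show "csubspace unitary_part" unfolding eq .
qed

lemma ST: "x \<in> unitary_part \<Longrightarrow> S (T x) = x"
  unfolding unitary_part_def by (drule CollectD, drule spec[of _ 1]) simp

lemma S_in_unitary_part: assumes "x \<in> unitary_part" shows "S x \<in> unitary_part"
proof -
  have "(S ^^ n) ((T ^^ n) (S x)) = S x" for n
  proof (cases n)
    case (Suc m)
    have "(T ^^ Suc m) (S x) = (T ^^ m) x" by (simp only: funpow_Suc_right o_def TS)
    then show ?thesis using assms Suc by (simp add: unitary_part_def)
  qed simp
  then show ?thesis by (simp add: unitary_part_def)
qed

lemma T_in_unitary_part: assumes "x \<in> unitary_part" shows "T x \<in> unitary_part"
proof -
  have "(S ^^ n) ((T ^^ n) (T x)) = T x" for n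
  proof -
    have "(S ^^ n) ((T ^^ n) (T x)) = T (S ((S ^^ n) ((T ^^ Suc n) x)))"
      by (simp only: TS funpow_Suc_right o_def)
    also have "S ((S ^^ n) ((T ^^ Suc n) x)) = (S ^^ Suc n) ((T ^^ Suc n) x)"
      by simp
    also have "\<dots> = x" using assms unfolding unitary_part_def by blast
    finally show ?thesis .
  qed
  then show ?thesis by (simp add: unitary_part_def)
qed

lemma S_pow_in: "x \<in> unitary_part \<Longrightarrow> (S ^^ n) x \<in> unitary_part"
  and T_pow_in: "x \<in> unitary_part \<Longrightarrow> (T ^^ n) x \<in> unitary_part"
  by (induction n) (simp_all add: S_in_unitary_part T_in_unitary_part)

text \<open>For \<open>z = (T ^^ n) x\<close>, the defect \<open>z - S (T z)\<close> lies in the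
  kernel of \<open>T\<close>. It is orthogonal to \<open>z\<close> by assumption and to the range of
  \<open>S\<close> anyway, hence to itself.\<close>

lemma in_unitary_partI:
  assumes "\<And>n k. T k = 0 \<Longrightarrow> cinner x ((S ^^ n) k) = 0"
  shows "x \<in> unitary_part"
proof -
  have "(S ^^ n) ((T ^^ n) x) = x" for n
  proof (induction n)
    case (Suc n)
    define z where "z = (T ^^ n) x"
    define k where "k = z - S (T z)"
    have "T k = 0" using T by (simp add: k_def bounded_clinear_simps TS)
    have "cinner z k = 0"
      using assms[OF \<open>T k = 0\<close>, of n] cinner_funpow_adjoint[of T S n x k, OF adj] by (simp add: z_def)
    moreover have "cinner (S (T z)) k = 0" by (simp add: adj' \<open>T k = 0\<close>)
    ultimately have "cinner k k = 0" by (simp add: k_def cinner_diff(1))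
    then have "S (T z) = z" by (simp add: cinner_eq_0_iff k_def)
    then have "(S ^^ n) (S (T z)) = x" using Suc by (simp add: z_def)
    then show ?case by (simp add: z_def funpow_swap1)
  qed simp
  then show ?thesis by (simp add: unitary_part_def)
qed

text \<open>With \<open>S\<close> acting as multiplication by \<open>z\<close> on the unitary part,
  \<open>F r\<close> is \<open>(1 + z)^r\<close> and \<open>G r\<close> is its conjugate
  \<open>(1 + 1/z)^r\<close>.\<close>

abbreviation "F \<equiv> binomial_op S"
abbreviation "G \<equiv> binomial_op T"

lemmas F_F = contraction.binomial_op_binomial_op[OF contraction_S]
lemmas G_G = contraction.binomial_op_binomial_op[OF contraction_T]
lemmas bounded_clinear_F = contraction.bounded_clinear_binomial_op[OF contraction_S]
lemmas bounded_clinear_G = contraction.bounded_clinear_binomial_op[OF contraction_T]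
lemmas F_1 = contraction.binomial_op_one[OF contraction_S]
lemmas G_1 = contraction.binomial_op_one[OF contraction_T]

lemma F_adj: "1 \<le> r \<Longrightarrow> cinner (F r x) y = cinner x (G r y)"
  and G_adj: "1 \<le> r \<Longrightarrow> cinner (G r x) y = cinner x (F r y)"
  by (rule binomial_op_adjoint; simp add: contraction_S contraction_T adj adj')+

lemma F_in: "1 \<le> r \<Longrightarrow> x \<in> unitary_part \<Longrightarrow> F r x \<in> unitary_part"
  using contraction.binomial_op_in_closed_csubspace[OF contraction_S _ closed_unitary_part csubspace_unitary_part]
    S_pow_in by blast

lemma G_in: "1 \<le> r \<Longrightarrow> x \<in> unitary_part \<Longrightarrow> G r x \<in> unitary_part"
  using contraction.binomial_op_in_closed_csubspace[OF contraction_T _ closed_unitary_part csubspace_unitary_part]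
    T_pow_in by blast

lemma S_T_pow:
  assumes "x \<in> unitary_part"
  shows "S ((T ^^ n) x) = (T ^^ n) (S x)"
  using assms
proof (induction n)
  case (Suc n)
  have "S ((T ^^ Suc n) x) = (T ^^ n) x" using ST[OF T_pow_in[OF Suc.prems, of n]]
    by (simp add: ST[OF T_pow_in[OF Suc.prems]])
  also have "\<dots> = (T ^^ Suc n) (S x)" by (simp only: funpow_Suc_right o_def TS)
  finally show ?case .
qed simp

lemma S_G: "1 \<le> r \<Longrightarrow> x \<in> unitary_part \<Longrightarrow> S (G r x) = G r (S x)"
  by (rule contraction.binomial_op_commute[OF contraction_T])
     (simp_all add: bounded_clinear_imp S S_T_pow)

lemma S_pow_G: "1 \<le> r \<Longrightarrow> x \<in> unitary_part \<Longrightarrow> G r ((S ^^ n) x) = (S ^^ n) (G r x)"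
  by (induction n) (simp_all add: S_G[symmetric] S_pow_in)

lemma F_G:
  assumes "1 \<le> r" "1 \<le> q" "x \<in> unitary_part"
  shows "G q (F r x) = F r (G q x)"
  by (rule contraction.binomial_op_commute[OF contraction_S])
     (simp_all add: assms bounded_clinear_imp bounded_clinear_G S_pow_G)

lemma F_1_eq: "x \<in> unitary_part \<Longrightarrow> F 1 x = S (G 1 x)"
  using S by (simp add: F_1 G_1 bounded_clinear_simps ST add.commute)

text \<open>On the unitary part \<open>F r\<close> commutes with its adjoint \<open>G r\<close>,
  that is, it is normal.\<close>

lemma norm_F_G:
  assumes "1 \<le> r" "x \<in> unitary_part" shows "norm (F r x) = norm (G r x)"
proof -
  have "cinner (F r x) (F r x) = cinner (G r x) (G r x)"
    using assms by (simp add: F_adj G_adj F_G)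
  then show ?thesis by (simp add: norm_eq_sqrt_cinner)
qed

text \<open>Only \<open>p + q\<close> matters, because \<open>1 + z\<close> and
  \<open>1 + 1/z\<close> have the same modulus. So passing from exponents \<open>(1, 2)\<close> to
  \<open>(1 + t, 2 - t)\<close> is isometric.\<close>

lemma cinner_FG:
  assumes "1 \<le> p" "1 \<le> q" "x \<in> unitary_part" "y \<in> unitary_part"
  shows "cinner (F p (G q x)) (F p (G q y)) = cinner (G (p + q) x) (G (p + q) y)"
proof -
  have "cinner (F p (G q x)) (F p (G q y)) = cinner (G q x) (F p (G p (G q y)))"
    using assms by (simp add: F_adj F_G G_in)
  also have "\<dots> = cinner (G p (G q x)) (G p (G q y))"
    using assms by (simp add: G_adj)
  finally show ?thesis using assms by (simp add: G_G)
qed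

section \<open>Eigenvectors of \<open>S\<close> for the eigenvalue \<open>-1\<close>\<close>

context
  fixes k assumes k: "S k = - k"
begin

lemma T_eigen: "T k = - k"
  using TS[of k] T k by (simp add: bounded_clinear_simps) (metis minus_minus)

lemma eigen_in: "k \<in> unitary_part"
proof -
  have "(S ^^ n) ((T ^^ n) k) = k" for n
  proof (induction n)
    case (Suc n)
    have "(S ^^ Suc n) ((T ^^ Suc n) k) = S ((S ^^ n) ((T ^^ n) (T k)))"
      by (simp add: funpow_swap1)
    also have "\<dots> = - S ((S ^^ n) ((T ^^ n) k))"
      using S bounded_clinear_funpow[OF S] bounded_clinear_funpow[OF T]
      by (simp add: T_eigen bounded_clinear_simps)
    finally show ?case by (simp add: Suc k)
  qed simp
  then show ?thesis by (simp add: unitary_part_def)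
qed

text \<open>The series is not evaluated at \<open>-1\<close>: the square of \<open>F r\<close>
  contains the factor \<open>F 1\<close>, which kills \<open>k\<close>, and a normal operator has
  the same kernel as its square.\<close>

lemma F_eigen: assumes "1 \<le> r" shows "F r k = 0"
proof -
  have "F r (F r k) = F (2 * r - 1) (F 1 k)" using assms by (simp add: F_F)
  also have "\<dots> = 0" using assms by (simp add: F_1 k bounded_clinear_simps bounded_clinear_F)
  finally have "norm (G r (F r k)) = 0"
    using norm_F_G[of r "F r k"] assms eigen_in F_in by simp
  then have "cinner (F r k) (F r k) = 0" using assms by (simp add: F_adj)
  then show ?thesis by (simp add: cinner_eq_0_iff)
qed

lemma G_eigen: "1 \<le> r \<Longrightarrow> G r k = 0"
  using norm_F_G[OF _ eigen_in, of r] F_eigen[of r] by simp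

end

text \<open>Testing with the adjoint of \<open>F 1 G 2\<close> applied to \<open>x\<close> gives
  \<open>F 3 x = 0\<close>. By normality already \<open>F 1 x = 0\<close>, so \<open>x\<close> is an
  eigenvector for \<open>-1\<close> and orthogonal to itself.\<close>

lemma unitary_part_total:
  assumes x: "x \<in> unitary_part"
    and FG: "\<And>y. y \<in> unitary_part \<Longrightarrow> cinner x (F 1 (G 2 y)) = 0"
    and k: "\<And>k. S k = - k \<Longrightarrow> cinner x k = 0"
  shows "x = 0"
proof -
  define z where "z = F 2 (G 1 x)"
  have z: "z \<in> unitary_part" using x by (simp add: z_def F_in G_in)
  have "cinner z z = cinner x (F 1 (G 2 z))" by (simp add: z_def F_adj G_adj)
  then have "F 2 (G 1 x) = 0" using FG[OF z] by (simp add: cinner_eq_0_iff z_def)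
  then have "norm (G 2 (G 1 x)) = 0" using norm_F_G[of 2 "G 1 x"] x by (simp add: G_in)
  then have "norm (F 3 x) = 0" using norm_F_G[of 3 x] x by (simp add: G_G)
  moreover have "F 3 x = F 1 (F 1 (F 1 x))" by (simp add: F_F)
  ultimately have FFF: "F 1 (F 1 (F 1 x)) = 0" by simp
  have ker: "F 1 y = 0" if y: "y \<in> unitary_part" "F 1 (F 1 y) = 0" for y
  proof -
    have "norm (G 1 (F 1 y)) = 0" using norm_F_G[of 1 "F 1 y"] y by (simp add: F_in)
    then have "cinner (F 1 y) (F 1 y) = 0" by (simp add: F_adj)
    then show ?thesis by (simp add: cinner_eq_0_iff)
  qed
  have "F 1 x = 0" using ker[OF x] ker[OF F_in[OF _ x] FFF] by simp
  then have "S x = - x" by (simp add: F_1 eq_neg_iff_add_eq_0 add.commute)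
  from k[OF this] show ?thesis by (simp add: cinner_eq_0_iff)
qed

end

text \<open>The Brownian family \<open>chi b\<close> spans the shift part: by Cooper's theorem an isometric semigroup
  is there the right shift on \<open>L\<^sup>2[0,\<infinity>)\<close>, under which the indicator of \<open>[0, s)\<close> is mapped to that
  of \<open>[t, s + t)\<close>.\<close>

locale brownian_isometry = isometry_adjoint +
  fixes I :: "'i set" and chi :: "'i \<Rightarrow> real \<Rightarrow> 'a"
  assumes cinner_chi: "\<lbrakk>b \<in> I; b' \<in> I; 0 \<le> s; 0 \<le> t\<rbrakk> \<Longrightarrow>
      cinner (chi b s) (chi b' t) = (if b = b' then of_real (min s t) else 0)"
    and S_chi: "\<lbrakk>b \<in> I; 0 \<le> s\<rbrakk> \<Longrightarrow> S (chi b s) = chi b (s + 1) - chi b 1"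
    and unitary_part_iff: "x \<in> unitary_part \<longleftrightarrow> (\<forall>b\<in>I. \<forall>s\<ge>0. cinner x (chi b s) = 0)"
begin

text \<open>On the unitary part, \<open>S\<close> acts as multiplication by \<open>z\<close> with \<open>|z| = 1\<close>, and \<open>z\<close> to the power
  \<open>t\<close> times \<open>(1 + z) (1 + 1/z)\<^sup>2\<close> equals \<open>(1 + z)\<close> to the power \<open>1 + t\<close> times \<open>1 + 1/z\<close> to the
  power \<open>2 - t\<close> unless \<open>z = - 1\<close>; both exponents stay where the binomial series converge uniformly.\<close>

definition pairs :: "real \<Rightarrow> ('a \<times> 'a) set" where
  "pairs t = {(F 1 (G 2 x), F (1 + t) (G (2 - t) x)) |x. x \<in> unitary_part}
    \<union> {(k, cis (pi * t) *\<^sub>C k) |k. S k = - k}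
    \<union> {(chi b s, chi b (s + t) - chi b t) |b s. b \<in> I \<and> 0 \<le> s}"

lemma pairsE:
  assumes "(a, b) \<in> pairs t"
  obtains x where "x \<in> unitary_part" "a = F 1 (G 2 x)" "b = F (1 + t) (G (2 - t) x)"
  | "S a = - a" "b = cis (pi * t) *\<^sub>C a"
  | i s where "i \<in> I" "0 \<le> s" "a = chi i s" "b = chi i (s + t) - chi i t"
  using assms unfolding pairs_def by blast

lemma unitary_chi:
  assumes "x \<in> unitary_part" "b \<in> I" "0 \<le> s"
  shows "cinner x (chi b s) = 0" "cinner (chi b s) x = 0"
  using assms unitary_part_iff cinner_eq_0_commute by blast+

text \<open>The three families are mutually orthogonal before and after the map. Within them, the
  exponents keep their sum 3, the factor \<open>cis (pi * t)\<close> is unimodular, and translation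
  by \<open>t\<close> preserves the overlap of intervals.\<close>

lemma pairs_gram:
  assumes t: "0 \<le> t" "t \<le> 1" and ab: "(a, b) \<in> pairs t" and ab': "(a', b') \<in> pairs t"
  shows "cinner b b' = cinner a a'"
proof -
  have k0: "cinner (F p (G q x)) k = 0" "cinner k (F p (G q x)) = 0"
    if "S k = - k" "1 \<le> p" for p q x k
  proof -
    show "cinner (F p (G q x)) k = 0" using that by (simp add: F_adj G_eigen)
    then show "cinner k (F p (G q x)) = 0" using cinner_eq_0_commute by blast
  qed
  have in1: "F p (G q x) \<in> unitary_part" if "x \<in> unitary_part" "1 \<le> p" "1 \<le> q" for p q x
    using that by (simp add: F_in G_in)
  have cis1: "cis (pi * t) * (cnj (cis (pi * t)) * z) = z" "cnj (cis (pi * t)) * (cis (pi * t) * z) = z" for z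
    by (simp_all add: cis_cnj cis_mult flip: mult.assoc)
  show ?thesis
    using ab
  proof (cases rule: pairsE)
    case (1 x)
    show ?thesis using ab'
    proof (cases rule: pairsE)
      case (1 y)
      then show ?thesis using \<open>x \<in> unitary_part\<close> \<open>a = _\<close> \<open>b = _\<close> t by (simp add: cinner_FG)
    next
      case 2
      then show ?thesis using \<open>a = _\<close> \<open>b = _\<close> t by (simp add: k0 cinner_simps)
    next
      case (3 i s)
      then show ?thesis using \<open>x \<in> unitary_part\<close> \<open>a = _\<close> \<open>b = _\<close> t
        by (simp add: cinner_simps unitary_chi in1)
    qed
  next
    case 2
    show ?thesis using ab'
    proof (cases rule: pairsE)
      case (1 y)
      then show ?thesis using 2 t by (simp add: k0 cinner_simps)
    next
      case 2
      then show ?thesis using \<open>b = _\<close> cis1 by (simp add: cinner_simps)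
    next
      case (3 i s)
      then show ?thesis using 2 t by (simp add: cinner_simps unitary_chi eigen_in)
    qed
  next
    case (3 i s)
    show ?thesis using ab'
    proof (cases rule: pairsE)
      case (1 y)
      then show ?thesis using 3 t by (simp add: cinner_simps unitary_chi in1)
    next
      case 2
      then show ?thesis using 3 t by (simp add: cinner_simps unitary_chi eigen_in)
    next
      case (3 i' s')
      have "min (s + t) (s' + t) = min s s' + t" by (simp add: min_def)
      then show ?thesis using 3 \<open>i \<in> I\<close> \<open>0 \<le> s\<close> \<open>a = _\<close> \<open>b = _\<close> t
        by (simp add: cinner_simps cinner_chi)
    qed
  qed
qed

lemma pairs_total:
  assumes "\<And>a b. (a, b) \<in> pairs t \<Longrightarrow> cinner x a = 0"
  shows "x = 0"
proof -
  have "cinner x (chi b s) = 0" if "b \<in> I" "0 \<le> s" for b s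
    by (rule assms[of _ "chi b (s + t) - chi b t"]) (use that in \<open>auto simp: pairs_def\<close>)
  then have x: "x \<in> unitary_part" using unitary_part_iff by blast
  show ?thesis
  proof (rule unitary_part_total[OF x])
    show "cinner x (F 1 (G 2 y)) = 0" if "y \<in> unitary_part" for y
      by (rule assms[of _ "F (1 + t) (G (2 - t) y)"]) (use that in \<open>auto simp: pairs_def\<close>)
    show "cinner x k = 0" if "S k = - k" for k
      by (rule assms[of _ "cis (pi * t) *\<^sub>C k"]) (use that in \<open>auto simp: pairs_def\<close>)
  qed
qed

text \<open>The first components of \<open>pairs t\<close> do not depend on \<open>t\<close>, so the
  value \<open>t = 0\<close> is taken in every application.\<close>

lemma pairs_induct:
  assumes "closed X" "csubspace X" and "\<And>a b. (a, b) \<in> pairs t \<Longrightarrow> a \<in> X"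
  shows "x \<in> X"
proof -
  have "UNIV \<subseteq> X"
  proof (rule total_set_induct[where A = "fst ` pairs t"])
    show "x = 0" if "\<And>a. a \<in> fst ` pairs t \<Longrightarrow> cinner x a = 0" for x
      by (rule pairs_total[of t]) (use that in force)
  qed (use assms in auto)
  then show ?thesis by blast
qed

definition V :: "real \<Rightarrow> 'a \<Rightarrow> 'a" where
  "V t = (SOME V. bounded_clinear V \<and> (\<forall>x y. cinner (V x) (V y) = cinner x y) \<and> (\<forall>(a, b)\<in>pairs t. V a = b))"

context
  fixes t :: real assumes t: "0 \<le> t" "t \<le> 1"
begin

lemma V_props:
  "bounded_clinear (V t) \<and> (\<forall>x y. cinner (V t x) (V t y) = cinner x y) \<and> (\<forall>(a, b)\<in>pairs t. V t a = b)"
proof -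
  have "\<exists>V. bounded_clinear V \<and> (\<forall>x y. cinner (V x) (V y) = cinner x y) \<and> (\<forall>(a, b)\<in>pairs t. V a = b)"
    by (rule isometry_extension) (erule (1) pairs_gram[OF t], rule pairs_total)
  from someI_ex[OF this] show ?thesis unfolding V_def .
qed

lemma bounded_clinear_V: "bounded_clinear (V t)"
  using V_props by blast

lemma norm_V: "norm (V t x) = norm x"
  using V_props by (simp add: norm_eq_sqrt_cinner)

lemma V_pairs: "(a, b) \<in> pairs t \<Longrightarrow> V t a = b"
  using V_props by auto

lemma V_F_G: "x \<in> unitary_part \<Longrightarrow> V t (F 1 (G 2 x)) = F (1 + t) (G (2 - t) x)"
  by (rule V_pairs) (auto simp: pairs_def)

lemma V_eigen: "S k = - k \<Longrightarrow> V t k = cis (pi * t) *\<^sub>C k"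
  by (rule V_pairs) (auto simp: pairs_def)

lemma V_chi: "b \<in> I \<Longrightarrow> 0 \<le> s \<Longrightarrow> V t (chi b s) = chi b (s + t) - chi b t"
  by (rule V_pairs) (auto simp: pairs_def)

text \<open>\<open>V t\<close> is prescribed for exponents \<open>(1, 2)\<close> only, but composing
  two of them meets others. On the total set the extra factors commute past \<open>F 1 G 2\<close>;
  \<open>1 + t \<le> q\<close> keeps \<open>q - t\<close> in the range of convergence.\<close>

lemma V_F_G_general:
  assumes p: "1 \<le> p" and q: "1 + t \<le> q" and x: "x \<in> unitary_part"
  shows "V t (F p (G q x)) = F (p + t) (G (q - t) x)"
proof -
  have q1: "1 \<le> q" "1 \<le> q - t" using q t by auto
  have bc: "bounded_clinear (V t \<circ> (F p \<circ> G q))" "bounded_clinear (F (p + t) \<circ> G (q - t))"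
    using p q1 t by (intro bounded_clinear_compose bounded_clinear_V bounded_clinear_F bounded_clinear_G; simp)+
  let ?A = "{F 1 (G 2 y) |y. y \<in> unitary_part} \<union> {k. S k = - k}"
  have "unitary_part \<subseteq> {x. (V t \<circ> (F p \<circ> G q)) x = (F (p + t) \<circ> G (q - t)) x}"
  proof (rule total_set_induct[where A = ?A, OF closed_unitary_part csubspace_unitary_part])
    show "?A \<subseteq> unitary_part" using F_in G_in eigen_in by auto
    show "x = 0" if "x \<in> unitary_part" "\<And>a. a \<in> ?A \<Longrightarrow> cinner x a = 0" for x
      by (rule unitary_part_total[OF that(1)]) (use that(2) in blast)+
    have "V t (F p (G q (F 1 (G 2 y)))) = F (p + t) (G (q - t) (F 1 (G 2 y)))"
      if y: "y \<in> unitary_part" for y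
    proof -
      have "F p (G q (F 1 (G 2 y))) = F 1 (G 2 (F p (G q y)))"
        using y p q1 by (simp add: F_G F_F G_G F_in G_in add.commute)
      also have "V t \<dots> = F (1 + t) (G (2 - t) (F p (G q y)))"
        using y p q1 by (intro V_F_G F_in G_in) auto
      also have "\<dots> = F (p + t) (G (q - t) (F 1 (G 2 y)))"
        using y p q1 t by (simp add: F_G F_F G_G F_in G_in algebra_simps)
      finally show ?thesis .
    qed
    moreover have "V t (F p (G q k)) = F (p + t) (G (q - t) k)" if "S k = - k" for k
      using that p q1 t bounded_clinear_V
      by (simp add: G_eigen bounded_clinear_simps bounded_clinear_F)
    ultimately show "?A \<subseteq> {x. (V t \<circ> (F p \<circ> G q)) x = (F (p + t) \<circ> G (q - t)) x}" by auto
  qed (rule equalizer_closed_csubspace[OF bc])+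
  then show ?thesis using x by auto
qed

end

lemma V_add:
  assumes "0 \<le> s" "0 \<le> t" "s + t \<le> 1"
  shows "V s (V t x) = V (s + t) x"
proof -
  have st: "s \<le> 1" "t \<le> 1" "0 \<le> s + t" using assms by auto
  have bc: "bounded_clinear (V s \<circ> V t)" "bounded_clinear (V (s + t))"
    using assms st by (intro bounded_clinear_compose bounded_clinear_V; simp)+
  have "x \<in> {x. (V s \<circ> V t) x = V (s + t) x}"
  proof (rule pairs_induct[OF equalizer_closed_csubspace[OF bc], where t = 0])
    fix a b assume "(a, b) \<in> pairs 0"
    then show "a \<in> {x. (V s \<circ> V t) x = V (s + t) x}"
    proof (cases rule: pairsE)
      case (1 x)
      \<comment> \<open>The assumption \<open>s + t \<le> 1\<close> is exactly the requirement
        \<open>1 + s \<le> 2 - t\<close>.\<close>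
      have "V s (F (1 + t) (G (2 - t) x)) = F (1 + t + s) (G (2 - t - s) x)"
        using 1 assms by (intro V_F_G_general) auto
      then show ?thesis using 1 assms st by (simp add: V_F_G algebra_simps)
    next
      case 2
      then show ?thesis using assms st bounded_clinear_V[of s]
        by (simp add: V_eigen bounded_clinear_simps scaleC_scaleC cis_mult algebra_simps)
    next
      case (3 i r)
      then show ?thesis using assms st bounded_clinear_V[of s]
        by (simp add: V_chi bounded_clinear_simps algebra_simps)
    qed
  qed
  then show ?thesis by simp
qed

text \<open>On the unitary part this is \<open>1 + z = z (1 + 1/z)\<close>, which trades one factor
  of \<open>G\<close> for one of \<open>F\<close>; on eigenvectors it is
  \<open>cis pi = -1\<close>.\<close>

lemma V_1: "V 1 x = S x"
proof -
  have bc: "bounded_clinear (V 1)" by (rule bounded_clinear_V) auto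
  have "x \<in> {x. V 1 x = S x}"
  proof (rule pairs_induct[OF equalizer_closed_csubspace[OF bc S], where t = 0])
    fix a b assume "(a, b) \<in> pairs 0"
    then show "a \<in> {x. V 1 x = S x}"
    proof (cases rule: pairsE)
      case (1 x)
      have "F 2 (G 1 x) = F 1 (F 1 (G 1 x))" by (simp add: F_F)
      also have "\<dots> = F 1 (G 1 (F 1 x))" using 1 by (simp add: F_G)
      also have "\<dots> = F 1 (G 1 (S (G 1 x)))" using 1 by (simp add: F_1_eq)
      also have "\<dots> = F 1 (S (G 1 (G 1 x)))" using 1 by (simp add: S_G G_in)
      also have "\<dots> = S (F 1 (G 2 x))" using S by (simp add: F_1 G_G bounded_clinear_simps)
      finally show ?thesis using 1 by (simp add: V_F_G)
    next
      case 2
      then show ?thesis by (simp add: V_eigen complex_vector.scale_minus_left scaleC_one)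
    next
      case (3 i r)
      then show ?thesis by (simp add: V_chi S_chi)
    qed
  qed
  then show ?thesis by simp
qed

text \<open>Both factors vary with \<open>t\<close>. The change of the inner one is controlled by
  the bound on \<open>F r\<close> common to all \<open>r\<close> in \<open>[1, 2]\<close>.\<close>

lemma continuous_on_F_G: "continuous_on {0..1} (\<lambda>t. F (1 + t) (G (2 - t) x))"
proof -
  note contF = contraction.continuous_on_binomial_op[OF contraction_S]
  note contG = contraction.continuous_on_binomial_op[OF contraction_T]
  obtain C where C: "\<And>r x. 1 \<le> r \<Longrightarrow> r \<le> 2 \<Longrightarrow> norm (F r x) \<le> C * norm x"
    using contraction.norm_binomial_op_le[OF contraction_S] by blast
  have g: "continuous_on {0..1} (\<lambda>t. G (2 - t) x)"
    by (rule continuous_on_compose2[OF contG]) (auto intro!: continuous_intros)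
  show ?thesis
    unfolding continuous_on_def
  proof
    fix u :: real assume u: "u \<in> {0..1}"
    have "continuous_on {0..1} (\<lambda>t. F (1 + t) (G (2 - u) x))"
      by (rule continuous_on_compose2[OF contF]) (auto intro!: continuous_intros)
    then have l1: "((\<lambda>t. F (1 + t) (G (2 - u) x)) \<longlongrightarrow> F (1 + u) (G (2 - u) x)) (at u within {0..1})"
      using u unfolding continuous_on_def by blast
    have "((\<lambda>t. C * norm (G (2 - t) x - G (2 - u) x)) \<longlongrightarrow> C * norm (G (2 - u) x - G (2 - u) x)) (at u within {0..1})"
      using g u unfolding continuous_on_def
      by (intro tendsto_mult tendsto_const tendsto_norm tendsto_diff) blast
    then have "((\<lambda>t. C * norm (G (2 - t) x - G (2 - u) x)) \<longlongrightarrow> 0) (at u within {0..1})" by simp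
    moreover have "\<forall>\<^sub>F t in at u within {0..1}. norm (F (1 + t) (G (2 - t) x - G (2 - u) x))
        \<le> C * norm (G (2 - t) x - G (2 - u) x)"
      unfolding eventually_at_filter by (rule always_eventually) (use C in auto)
    ultimately have l2: "((\<lambda>t. F (1 + t) (G (2 - t) x - G (2 - u) x)) \<longlongrightarrow> 0) (at u within {0..1})"
      by (rule Lim_null_comparison[rotated])
    have "\<forall>\<^sub>F t in at u within {0..1}. F (1 + t) (G (2 - u) x) + F (1 + t) (G (2 - t) x - G (2 - u) x)
        = F (1 + t) (G (2 - t) x)"
      unfolding eventually_at_filter
      by (rule always_eventually) (auto simp: bounded_clinear_F simp flip: bounded_clinear_add)
    from tendsto_cong[OF this] tendsto_add[OF l1 l2]
    show "((\<lambda>t. F (1 + t) (G (2 - t) x)) \<longlongrightarrow> F (1 + u) (G (2 - u) x)) (at u within {0..1})" by simp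
  qed
qed

lemma chi_continuous:
  assumes "b \<in> I" "0 \<le> s"
  shows "((\<lambda>t. chi b (s + t)) \<longlongrightarrow> chi b s) (at 0 within {0..1})"
proof -
  have sq: "((\<lambda>t::real. sqrt t) \<longlongrightarrow> sqrt 0) (at 0 within {0..1})" by (intro tendsto_intros)
  have "norm (chi b (s + t) - chi b s) \<le> sqrt t" if "0 \<le> t" for t
  proof -
    have "cinner (chi b (s + t) - chi b s) (chi b (s + t) - chi b s) = of_real t"
      using assms that by (simp add: cinner_simps cinner_chi)
    then show ?thesis by (simp add: norm_eq_sqrt_cinner)
  qed
  then have ev: "\<forall>\<^sub>F t in at 0 within {0..1}. norm (chi b (s + t) - chi b s) \<le> sqrt t"
    unfolding eventually_at_filter by (intro always_eventually) auto
  have "((\<lambda>t. chi b (s + t) - chi b s) \<longlongrightarrow> 0) (at 0 within {0..1})"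
    by (rule Lim_null_comparison[OF ev]) (use sq in simp)
  then show ?thesis by (simp add: LIM_zero_iff)
qed

text \<open>The vectors with this property form a subspace that is closed since all
  \<open>V t\<close> are isometric, so the total set suffices.\<close>

lemma V_continuous_0: "((\<lambda>t. V t x) \<longlongrightarrow> x) (at 0 within {0..1})"
proof -
  let ?L = "at 0 within {0..1::real}"
  let ?X = "{x. ((\<lambda>t. V t x) \<longlongrightarrow> x) ?L}"
  have ev: "(\<And>t. 0 \<le> t \<Longrightarrow> t \<le> 1 \<Longrightarrow> P t) \<Longrightarrow> eventually P ?L" for P
    unfolding eventually_at_filter by (rule always_eventually) auto
  have sub: "csubspace ?X"
  proof (rule complex_vector.subspaceI)
    show "0 \<in> ?X"
      using tendsto_cong[OF ev, of "\<lambda>t. V t 0" "\<lambda>t. 0"] by (simp add: bounded_clinear_V bounded_clinear_zero)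
  next
    fix x y assume "x \<in> ?X" "y \<in> ?X"
    then have "((\<lambda>t. V t x + V t y) \<longlongrightarrow> x + y) ?L" by (auto intro: tendsto_add)
    then show "x + y \<in> ?X"
      using tendsto_cong[OF ev, of "\<lambda>t. V t (x + y)" "\<lambda>t. V t x + V t y"]
      by (simp add: bounded_clinear_V bounded_clinear_add)
  next
    fix c x assume "x \<in> ?X"
    then have "((\<lambda>t. norm (V t x - x)) \<longlongrightarrow> 0) ?L" by (simp add: tendsto_norm_zero_iff LIM_zero_iff)
    then have "((\<lambda>t. cmod c * norm (V t x - x)) \<longlongrightarrow> 0) ?L" by (rule tendsto_mult_right_zero)
    then have "((\<lambda>t. norm (c *\<^sub>C V t x - c *\<^sub>C x)) \<longlongrightarrow> 0) ?L"
      by (simp add: norm_scaleC flip: complex_vector.scale_right_diff_distrib)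
    then have "((\<lambda>t. c *\<^sub>C V t x) \<longlongrightarrow> c *\<^sub>C x) ?L" by (simp add: tendsto_norm_zero_iff LIM_zero_iff)
    then show "c *\<^sub>C x \<in> ?X"
      using tendsto_cong[OF ev, of "\<lambda>t. V t (c *\<^sub>C x)" "\<lambda>t. c *\<^sub>C V t x"]
      by (simp add: bounded_clinear_V bounded_clinear_scaleC)
  qed
  have "closed ?X"
    unfolding closed_sequential_limits
  proof (intro allI impI, elim conjE)
    fix y x assume y: "\<forall>n. y n \<in> ?X" and lim: "y \<longlonglongrightarrow> x"
    have "((\<lambda>t. V t x) \<longlongrightarrow> x) ?L"
    proof (rule tendstoI)
      fix \<epsilon> :: real assume \<epsilon>: "0 < \<epsilon>"
      then obtain n where n: "dist (y n) x < \<epsilon> / 3"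
        using metric_LIMSEQ_D[OF lim, of "\<epsilon> / 3"] by auto
      have "\<forall>\<^sub>F t in ?L. dist (V t (y n)) (y n) < \<epsilon> / 3"
        using y \<epsilon> by (intro tendstoD) auto
      moreover have "\<forall>\<^sub>F t in ?L. dist (V t x) (V t (y n)) = dist x (y n)"
        by (rule ev) (simp add: dist_norm norm_V bounded_clinear_V flip: bounded_clinear_diff)
      ultimately show "\<forall>\<^sub>F t in ?L. dist (V t x) x < \<epsilon>"
      proof eventually_elim
        case (elim t)
        then show ?case using n dist_triangle[of "V t x" x "V t (y n)"] dist_triangle[of "V t (y n)" x "y n"]
          by (simp add: dist_commute)
      qed
    qed
    then show "x \<in> ?X" by simp
  qed
  then have "x \<in> ?X"
  proof (rule pairs_induct[OF _ sub, where t = 0])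
    fix a b assume "(a, b) \<in> pairs 0"
    then show "a \<in> ?X"
    proof (cases rule: pairsE)
      case (1 x)
      have "((\<lambda>t. F (1 + t) (G (2 - t) x)) \<longlongrightarrow> F (1 + 0) (G (2 - 0) x)) ?L"
        using continuous_on_F_G[of x] unfolding continuous_on_def by (rule bspec) simp
      then show ?thesis
        using 1 tendsto_cong[OF ev, of "\<lambda>t. V t a" "\<lambda>t. F (1 + t) (G (2 - t) x)"] by (simp add: V_F_G)
    next
      case 2
      have "((\<lambda>t. norm (cis (pi * t) - 1)) \<longlongrightarrow> norm (cis (pi * 0) - 1)) ?L"
        unfolding cis_conv_exp by (intro tendsto_intros)
      then have "((\<lambda>t. norm (cis (pi * t) - 1) * norm a) \<longlongrightarrow> 0) ?L"
        by (intro tendsto_mult_left_zero) simp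
      then have "((\<lambda>t. norm (cis (pi * t) *\<^sub>C a - a)) \<longlongrightarrow> 0) ?L"
        by (simp add: complex_vector.scale_left_diff_distrib scaleC_one flip: norm_scaleC)
      then have "((\<lambda>t. cis (pi * t) *\<^sub>C a) \<longlongrightarrow> a) ?L" by (simp add: tendsto_norm_zero_iff LIM_zero_iff)
      then show ?thesis
        using 2 tendsto_cong[OF ev, of "\<lambda>t. V t a" "\<lambda>t. cis (pi * t) *\<^sub>C a"] by (simp add: V_eigen)
    next
      case (3 i s)
      have "chi i 0 = 0" using cinner_chi[of i i 0 0] 3 by (simp add: cinner_eq_0_iff)
      then have "((\<lambda>t. chi i (s + t) - chi i t) \<longlongrightarrow> chi i s - 0) ?L"
        using chi_continuous[of i s] chi_continuous[of i 0] 3 by (intro tendsto_diff) simp_all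
      then show ?thesis
        using 3 tendsto_cong[OF ev, of "\<lambda>t. V t a" "\<lambda>t. chi i (s + t) - chi i t"] by (simp add: V_chi)
    qed
  qed
  then show ?thesis by simp
qed

end

section \<open>From times in \<open>[0, 1]\<close> to the full semigroup, and its adjoint\<close>

context brownian_isometry
begin

lemma S_V: assumes "0 \<le> t" "t \<le> 1" shows "S (V t x) = V t (S x)"
proof -
  have "S (V t x) = V t (V (1 - t) (V t x))" using assms V_add[of t "1 - t" "V t x"] by (simp add: V_1)
  also have "V (1 - t) (V t x) = S x" using assms V_add[of "1 - t" t x] by (simp add: V_1)
  finally show ?thesis .
qed

lemma S_pow_V: "0 \<le> t \<Longrightarrow> t \<le> 1 \<Longrightarrow> V t ((S ^^ n) x) = (S ^^ n) (V t x)"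
  by (induction n) (simp_all add: S_V[symmetric])

text \<open>For negative \<open>t\<close> the power of \<open>S\<close> is trivial, so
  \<open>U t\<close> is an isometry for every real \<open>t\<close> and adjoints can be chosen for
  all times at once.\<close>

definition U :: "real \<Rightarrow> 'a \<Rightarrow> 'a" where "U t x = (S ^^ nat \<lfloor>t\<rfloor>) (V (frac t) x)"

lemma frac_bounds: "0 \<le> frac t" "frac t \<le> 1"
  using frac_lt_1[of t] by simp_all

lemma bounded_clinear_U: "bounded_clinear (U t)"
proof -
  have "U t = (S ^^ nat \<lfloor>t\<rfloor>) \<circ> V (frac t)" by (auto simp: U_def)
  then show ?thesis
    by (simp only: bounded_clinear_compose bounded_clinear_funpow S bounded_clinear_V frac_bounds)
qed

lemma norm_U: "norm (U t x) = norm x"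
proof -
  have "norm ((S ^^ n) y) = norm y" for n y by (induction n) (simp_all add: norm_S)
  then show ?thesis by (simp only: U_def norm_V frac_bounds)
qed

lemma U_add:
  assumes "0 \<le> s" "0 \<le> t"
  shows "U s (U t x) = U (s + t) x"
proof -
  have nn: "0 \<le> \<lfloor>s\<rfloor>" "0 \<le> \<lfloor>t\<rfloor>" using assms by simp_all
  have *: "U s (U t x) = (S ^^ (nat \<lfloor>s\<rfloor> + nat \<lfloor>t\<rfloor>)) (V (frac s) (V (frac t) x))"
    by (simp only: U_def S_pow_V frac_bounds funpow_add o_def)
  show ?thesis
  proof (cases "frac s + frac t < 1")
    case True
    have "nat \<lfloor>s + t\<rfloor> = nat \<lfloor>s\<rfloor> + nat \<lfloor>t\<rfloor>" using True nn by (simp add: floor_add nat_add_distrib)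
    then show ?thesis unfolding * using True by (simp add: U_def V_add frac_add frac_bounds)
  next
    case False
    have n: "nat \<lfloor>s + t\<rfloor> = Suc (nat \<lfloor>s\<rfloor> + nat \<lfloor>t\<rfloor>)" using False nn by (simp add: floor_add nat_add_distrib)
    have le: "frac s + frac t - 1 \<le> frac s" using frac_bounds[of t] by simp
    \<comment> \<open>The carry: \<open>frac t\<close> is split as
      \<open>(1 - frac s) + (frac s + frac t - 1)\<close>, so that the first piece completes
      \<open>frac s\<close> to 1.\<close>
    have "V (frac s) (V (frac t) x) = V (frac s) (V (1 - frac s) (V (frac s + frac t - 1) x))"
      using False frac_bounds[of s] frac_bounds[of t] by (simp add: V_add)
    also have "\<dots> = S (V (frac s + frac t - 1) x)"
      using frac_bounds[of s] by (simp add: V_add V_1)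
    finally show ?thesis unfolding * using False n
      by (simp add: U_def frac_add funpow_swap1)
  qed
qed

lemma U_0: "U 0 x = x"
proof -
  have "x \<in> {x. V 0 x = id x}"
  proof (rule pairs_induct[where t = 0])
    show "closed {x. V 0 x = id x}" "csubspace {x. V 0 x = id x}"
      by (rule equalizer_closed_csubspace[OF bounded_clinear_V bounded_clinear_id]; simp)+
    fix a b assume "(a, b) \<in> pairs 0"
    then show "a \<in> {x. V 0 x = id x}"
    proof (cases rule: pairsE)
      case (3 i s)
      have "chi i 0 = 0" using cinner_chi[of i i 0 0] 3 by (simp add: cinner_eq_0_iff)
      then show ?thesis using 3 by (simp add: V_chi)
    qed (simp_all add: V_F_G V_eigen scaleC_one)
  qed
  then show ?thesis by (simp add: U_def)
qed

lemma U_1: "U 1 x = S x"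
  using U_0[of "S x"] by (simp add: U_def S_V)

lemma U_near_0:
  assumes "0 < \<epsilon>"
  shows "\<exists>\<delta>>0. \<forall>h. 0 \<le> h \<and> h < \<delta> \<longrightarrow> norm (U h x - x) < \<epsilon>"
proof -
  obtain \<delta> where \<delta>: "0 < \<delta>" "\<And>h. h \<in> {0..1} \<Longrightarrow> h \<noteq> 0 \<Longrightarrow> dist h 0 < \<delta> \<Longrightarrow> dist (V h x) x < \<epsilon>"
    using tendstoD[OF V_continuous_0[of x] assms] unfolding eventually_at by blast
  have "norm (U h x - x) < \<epsilon>" if "0 \<le> h" "h < min \<delta> 1" for h
  proof (cases "h = 0")
    case False
    have "frac h = h" "\<lfloor>h\<rfloor> = 0" using that by (simp_all add: frac_eq floor_eq_iff)
    then show ?thesis using \<delta>(2)[of h] that False by (simp add: U_def dist_norm)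
  qed (use assms in \<open>simp add: U_0\<close>)
  moreover have "0 < min \<delta> 1" using \<delta>(1) by simp
  ultimately show ?thesis by blast
qed

text \<open>The adjoints of an isometric semigroup form a strongly continuous semigroup because
  \<open>W h x - x = W h (x - U h x)\<close>, where \<open>W h\<close> is the adjoint of \<open>U h\<close>.\<close>

lemma embeddable_adjoint: "embeddable T"
proof -
  have "\<exists>W. \<forall>x y. cinner (U t x) y = cinner x (W y)" for t
    by (rule adjoint_exists[OF bounded_clinear_U])
  then obtain W where W: "\<And>t x y. cinner (U t x) y = cinner x (W t y)" by metis
  have bW: "bounded_clinear (W t)" for t
    by (rule adjoint_bounded_clinear[OF bounded_clinear_imp[OF bounded_clinear_U] W])
  have W': "cinner (W t x) y = cinner x (U t y)" for t x y
    using cinner_commute[of "W t x" y] cinner_commute[of x "U t y"] W[of t y x] by simp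
  have nW: "norm (W t x) \<le> norm x" for t x
    by (rule contraction_adjoint[OF W']) (simp add: norm_U)
  have W0: "W 0 = id" by (rule ext, rule cinner_eqI') (simp add: U_0 flip: W)
  have W1: "W 1 = T"
    by (rule ext, rule cinner_eqI') (simp add: U_1 adj' flip: W)
  have W_add: "W s (W t x) = W (s + t) x" if "0 \<le> s" "0 \<le> t" for s t x
    by (rule cinner_eqI') (simp add: U_add that add.commute flip: W)
  have WU: "W t (U t x) = x" for t x
  proof (rule cinner_eqI')
    fix z show "cinner z (W t (U t x)) = cinner z x"
      using norm_preserving_imp_cinner[OF bounded_clinear_U norm_U, of t z x] by (simp flip: W)
  qed
  have diff: "norm (W t x - W s x) \<le> norm (U (t - s) x - x)" if "0 \<le> s" "s \<le> t" for s t x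
  proof -
    have "W t x - W s x = W s (W (t - s) (x - U (t - s) x))"
      using that bW W_add[of s "t - s"] by (simp add: bounded_clinear_diff WU)
    also have "norm \<dots> \<le> norm (x - U (t - s) x)"
      using nW order_trans by blast
    finally show ?thesis by (simp add: norm_minus_commute)
  qed
  have "continuous_on {0..} (\<lambda>t. W t x)" for x
    unfolding continuous_on_iff
  proof (intro ballI allI impI)
    fix s \<epsilon> :: real assume s: "s \<in> {0..}" and \<epsilon>: "0 < \<epsilon>"
    from U_near_0[OF \<epsilon>, of x] obtain \<delta>
      where \<delta>: "0 < \<delta>" "\<And>h. 0 \<le> h \<Longrightarrow> h < \<delta> \<Longrightarrow> norm (U h x - x) < \<epsilon>" by blast
    have "dist (W t x) (W s x) < \<epsilon>" if t: "t \<in> {0..}" "dist t s < \<delta>" for t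
    proof (cases "s \<le> t")
      case True
      then show ?thesis using diff[of s t x] \<delta>(2)[of "t - s"] s t by (simp add: dist_norm)
    next
      case False
      then show ?thesis using diff[of t s x] \<delta>(2)[of "s - t"] s t
        by (simp add: dist_norm norm_minus_commute)
    qed
    then show "\<exists>\<delta>>0. \<forall>t\<in>{0..}. dist t s < \<delta> \<longrightarrow> dist (W t x) (W s x) < \<epsilon>"
      using \<delta>(1) by blast
  qed
  then have "C0_semigroup W"
    unfolding C0_semigroup_def using bW W0 W_add by (auto simp: o_def)
  then show ?thesis unfolding embeddable_def using W1 by blast
qed

end

section \<open>Orthonormal bases and the shift part\<close>

definition orthonormal :: "'a::complex_inner set \<Rightarrow> bool" where
  "orthonormal E \<longleftrightarrow> (\<forall>x\<in>E. \<forall>y\<in>E. cinner x y = (if x = y then 1 else 0))"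

text \<open>For a maximal orthonormal subset of \<open>M\<close>, a nonzero vector of
  \<open>M\<close> orthogonal to it could be normalised and added.\<close>

lemma orthonormal_basis_exists:
  fixes M :: "'a::complex_inner set"
  assumes M: "csubspace M"
  shows "\<exists>E\<subseteq>M. orthonormal E \<and> (\<forall>x\<in>M. (\<forall>e\<in>E. cinner x e = 0) \<longrightarrow> x = 0)"
proof -
  let ?A = "{E. E \<subseteq> M \<and> orthonormal E}"
  have "\<exists>E\<in>?A. \<forall>X\<in>?A. E \<subseteq> X \<longrightarrow> X = E"
  proof (rule subset_Zorn')
    fix C assume C: "subset.chain ?A C"
    have "orthonormal (\<Union> C)"
      unfolding orthonormal_def
    proof (intro ballI)
      fix x y assume "x \<in> \<Union> C" "y \<in> \<Union> C"
      then obtain X Y where XY: "x \<in> X" "X \<in> C" "y \<in> Y" "Y \<in> C" by blast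
      then have "X \<subseteq> Y \<or> Y \<subseteq> X" using C unfolding subset.chain_def by blast
      then obtain Z where "Z \<in> C" "x \<in> Z" "y \<in> Z" using XY by blast
      then show "cinner x y = (if x = y then 1 else 0)"
        using C unfolding subset.chain_def orthonormal_def by blast
    qed
    then show "\<Union> C \<in> ?A" using C unfolding subset.chain_def by blast
  qed
  then obtain E where "E \<in> ?A" and max': "\<forall>X\<in>?A. E \<subseteq> X \<longrightarrow> X = E" by (rule bexE)
  then have E: "E \<subseteq> M" "orthonormal E" by simp_all
  have max: "X = E" if "X \<subseteq> M" "orthonormal X" "E \<subseteq> X" for X using max' that by simp
  have "x = 0" if x: "x \<in> M" "\<forall>e\<in>E. cinner x e = 0" for x
  proof (rule ccontr)
    assume x0: "x \<noteq> 0"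
    define u where "u = (1 / complex_of_real (norm x)) *\<^sub>C x"
    have uu: "cinner u u = 1"
      using x0 by (simp add: u_def cinner_self norm_scaleC norm_divide)
    have ue: "cinner u e = 0" "cinner e u = 0" if "e \<in> E" for e
      using x(2) that cinner_eq_0_commute[of e x] by (simp_all add: u_def cinner_simps)
    have "orthonormal (insert u E)"
      using E(2) uu ue unfolding orthonormal_def by auto
    moreover have "insert u E \<subseteq> M"
      using E(1) x(1) M by (simp add: u_def complex_vector.subspace_scale)
    ultimately have "u \<in> E" using max by blast
    then show False using ue(1) uu by fastforce
  qed
  then show ?thesis using E by blast
qed

lemma finite_orthonormal_basis_imp_finite_cdim:
  fixes M :: "'a::complex_inner set"
  assumes M: "csubspace M" and E: "E \<subseteq> M" "orthonormal E" "finite E"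
    and max: "\<And>x. x \<in> M \<Longrightarrow> (\<And>e. e \<in> E \<Longrightarrow> cinner x e = 0) \<Longrightarrow> x = 0"
  shows "finite_cdim M"
proof -
  have "cspan E = M"
  proof (rule antisym)
    show "cspan E \<subseteq> M" using E(1) M by (rule complex_vector.span_minimal)
    show "M \<subseteq> cspan E"
    proof
      fix x assume x: "x \<in> M"
      define p where "p = (\<Sum>e\<in>E. cinner x e *\<^sub>C e)"
      have pE: "p \<in> cspan E" unfolding p_def
        by (intro complex_vector.span_sum complex_vector.span_scale complex_vector.span_base)
      then have "p \<in> M" using \<open>cspan E \<subseteq> M\<close> by blast
      have "cinner (x - p) e = 0" if "e \<in> E" for e
      proof -
        have "cinner p e = (\<Sum>d\<in>E. if d = e then cinner x e else 0)"
          unfolding p_def cinner_sum(1) using E(2) that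
          by (intro sum.cong) (auto simp: cinner_simps orthonormal_def)
        then show ?thesis using E(3) that by (simp add: cinner_diff)
      qed
      moreover have "x - p \<in> M" using x \<open>p \<in> M\<close> M by (simp add: complex_vector.subspace_diff)
      ultimately have "x - p = 0" by (intro max)
      then show "x \<in> cspan E" using pE by simp
    qed
  qed
  then show ?thesis using E(3) unfolding finite_cdim_def by blast
qed

lemma infinite_bij_times_nat:
  assumes "infinite E"
  shows "\<exists>g. bij_betw g (E \<times> (UNIV :: nat set)) E"
  using card_of_Times_infinite_simps(1)[OF assms UNIV_not_empty, where ?'b = nat] assms
    infinite_iff_card_of_nat[of E] card_of_ordIso by blast

text \<open>The numbers \<open>2 ^ j + k\<close> with \<open>k < 2 ^ j\<close> enumerate the Haar
  functions of the unit interval without repetition; 0 remains for the constant function.\<close>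

lemma heap_index_eq:
  assumes "2 ^ i + k = 2 ^ j + (l::nat)" "k < 2 ^ i" "l < 2 ^ j"
  shows "i = j \<and> k = l"
proof -
  have "\<not> i < j" if "2 ^ i + k = 2 ^ j + l" "k < 2 ^ i" for i j k l :: nat
  proof
    assume "i < j"
    then have "(2::nat) ^ Suc i \<le> 2 ^ j" by (intro power_increasing) auto
    then show False using that by simp
  qed
  from this[OF assms(1,2)] this[OF assms(1)[symmetric] assms(3)] assms(1) show ?thesis
    by (simp add: antisym_conv3)
qed

lemma heap_index_exists:
  assumes "n \<noteq> 0"
  obtains j k :: nat where "n = 2 ^ j + k" "k < 2 ^ j"
proof -
  obtain j where j: "2 ^ j \<le> n" "n < 2 ^ (j + 1)" using ex_power_ivl1[of 2 n] assms by auto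
  then show ?thesis using that[of j "n - 2 ^ j"] by simp
qed

section \<open>The shift part generated by the kernel of \<open>T\<close>, and the two
  embeddings\<close>

context isometry_adjoint
begin

lemma S_pow_cinner: "cinner ((S ^^ n) x) ((S ^^ n) y) = cinner x y"
  by (induction n) (simp_all add: cinner_S)

lemma S_pow_kernel_cinner:
  assumes "T u = 0" "T v = 0"
  shows "cinner ((S ^^ k) u) ((S ^^ l) v) = (if k = l then cinner u v else 0)"
proof -
  have *: "cinner ((S ^^ k) u) ((S ^^ l) v) = 0" if u: "T u = 0" and less: "k < l" for k l u v
  proof -
    obtain m where l: "l = k + Suc m" using less less_iff_Suc_add by auto
    have "cinner ((S ^^ k) u) ((S ^^ l) v) = cinner u ((S ^^ Suc m) v)"
      unfolding l funpow_add o_def by (rule S_pow_cinner)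
    also have "\<dots> = cinner (T u) ((S ^^ m) v)" by (simp add: adj)
    finally show ?thesis using u by simp
  qed
  consider "k = l" | "k < l" | "l < k" by linarith
  then show ?thesis
  proof cases
    case 3
    then have "cinner ((S ^^ l) v) ((S ^^ k) u) = 0" using *[OF assms(2)] by blast
    then show ?thesis using 3 cinner_eq_0_commute by auto
  qed (simp_all add: S_pow_cinner *[OF assms(1)])
qed

lemma unitary_part_kernel:
  assumes x: "x \<in> unitary_part" and k: "T k = 0"
  shows "cinner x ((S ^^ n) k) = 0"
proof -
  \<comment> \<open>One power more than \<open>n\<close>: after cancelling \<open>n\<close> of them
    a vector of the range of \<open>S\<close> is left, which is orthogonal to the kernel of
    \<open>T\<close>.\<close>
  have "(S ^^ Suc n) ((T ^^ Suc n) x) = x" using x unfolding unitary_part_def by blast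
  then have "x = (S ^^ Suc n) ((T ^^ Suc n) x)" by (rule sym)
  also have "\<dots> = (S ^^ n) (S ((T ^^ Suc n) x))" by (simp only: funpow_Suc_right o_def)
  finally have "cinner x ((S ^^ n) k) = cinner (S ((T ^^ Suc n) x)) k" using S_pow_cinner by metis
  then show ?thesis by (simp only: adj' k cinner_zero)
qed

text \<open>With trivial kernel the unitary part is everything, and the Brownian family is
  empty.\<close>

lemma embeddable_if_injective:
  assumes "\<And>k. T k = 0 \<Longrightarrow> k = 0"
  shows "embeddable T"
proof -
  have "bounded_clinear (S ^^ n)" for n by (rule bounded_clinear_funpow[OF S])
  then have "x \<in> unitary_part" for x
    by (intro in_unitary_partI) (auto dest: assms simp: bounded_clinear_zero)
  then interpret brownian_isometry S T "{} :: 'a set" "\<lambda>_ _. 0"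
    by unfold_locales auto
  show ?thesis by (rule embeddable_adjoint)
qed

lemma embeddable_if_infinite_kernel:
  assumes inf: "\<not> finite_cdim {x. T x = 0}"
  shows "embeddable T"
proof -
  define K where "K = {x. T x = 0}"
  have K: "csubspace K" unfolding K_def
    by (rule complex_vector.subspaceI) (use T in \<open>simp_all add: bounded_clinear_simps\<close>)
  have clK: "closed K" unfolding K_def
    by (intro closed_Collect_eq bounded_clinear_continuous_on T continuous_on_const)
  obtain E where E: "E \<subseteq> K" "orthonormal E"
    and max: "\<And>x. x \<in> K \<Longrightarrow> (\<And>e. e \<in> E \<Longrightarrow> cinner x e = 0) \<Longrightarrow> x = 0"
    using orthonormal_basis_exists[OF K] by blast
  have "infinite E"
    using finite_orthonormal_basis_imp_finite_cdim[OF K E _ max] inf unfolding K_def by blast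
  then obtain g where g: "bij_betw g (E \<times> (UNIV :: nat set)) E"
    using infinite_bij_times_nat by blast
  have gE: "g (b, n) \<in> E" if "b \<in> E" for b n using g that unfolding bij_betw_def by auto
  have Tg: "T (g (b, n)) = 0" if "b \<in> E" for b n using gE[OF that] E(1) K_def by auto
  have gg: "cinner ((S ^^ k) (g (b, n))) ((S ^^ k') (g (b', n')))
      = (if k = k' \<and> b = b' \<and> n = n' then 1 else 0)" if "b \<in> E" "b' \<in> E" for k k' b b' n n'
  proof -
    have "g (b, n) = g (b', n') \<longleftrightarrow> b = b' \<and> n = n'"
      using g that unfolding bij_betw_def inj_on_def by auto
    moreover have "cinner (g (b, n)) (g (b', n')) = (if g (b, n) = g (b', n') then 1 else 0)"
      using E(2) gE that unfolding orthonormal_def by blast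
    moreover have "cinner (g (b', n')) (g (b', n')) = 1"
      using E(2) gE that unfolding orthonormal_def by presburger
    ultimately show ?thesis using S_pow_kernel_cinner[OF Tg Tg] that by simp
  qed
  \<comment> \<open>The basis vector with number 0 models the constant function 1 on
    \<open>[0, 1)\<close>.\<close>
  define f where "f b k = (S ^^ k) (g (b, 0))" for b k
  \<comment> \<open>The interval \<open>[k / 2^j, (k + 1) / 2^j)\<close> lies in the unit interval
    number \<open>k div 2 ^ j\<close>, at place \<open>k mod 2 ^ j\<close> there; its Haar function
    is the translate of the one with heap number \<open>2 ^ j + k mod 2 ^ j\<close>.\<close>
  define e where "e b j k = (S ^^ (k div 2 ^ j)) (g (b, 2 ^ j + k mod 2 ^ j))" for b j k
  have hs: "haar_system (f b) (e b)" if b: "b \<in> E" for b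
  proof
    fix i j k l
    show "cinner (f b k) (f b l) = (if k = l then 1 else 0)" by (simp add: f_def gg b)
    show "cinner (f b k) (e b j l) = 0" by (simp add: f_def e_def gg b)
    have "k = l" if "i = j" "k div 2 ^ i = l div 2 ^ j" "k mod 2 ^ i = l mod 2 ^ j"
      using that by (metis div_mult_mod_eq)
    then show "cinner (e b i k) (e b j l) = (if i = j \<and> k = l then 1 else 0)"
      using heap_index_eq[of i "k mod 2 ^ i" j "l mod 2 ^ j"] by (auto simp: e_def gg b)
  qed
  define chi where "chi b = haar_system.chi (f b) (e b)" for b
  note orth_iff = haar_system.orthogonal_chi_iff[OF hs, folded chi_def]
  have cross: "cinner (chi b s) (chi b' t) = 0"
    if b: "b \<in> E" "b' \<in> E" "b \<noteq> b'" and st: "0 \<le> s" "0 \<le> t" for b b' s t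
  proof -
    \<comment> \<open>Orthogonality of the Haar systems is carried over to \<open>chi\<close> in one
      argument at a time.\<close>
    have "cinner (f b k) (chi b' t) = 0" "cinner (e b j k) (chi b' t) = 0" for j k
      using orth_iff[OF b(2), of "f b k"] orth_iff[OF b(2), of "e b j k"] b st
      by (simp_all add: f_def e_def gg)
    then have "cinner (chi b' t) (f b k) = 0" "cinner (chi b' t) (e b j k) = 0" for j k
      using cinner_eq_0_commute by blast+
    then have "cinner (chi b' t) (chi b s) = 0" using orth_iff[OF b(1)] st by blast
    then show ?thesis using cinner_eq_0_commute by blast
  qed
  interpret brownian_isometry S T E chi
  proof
    show "cinner (chi b s) (chi b' t) = (if b = b' then of_real (min s t) else 0)"
      if "b \<in> E" "b' \<in> E" "0 \<le> s" "0 \<le> t" for b b' s t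
      using that cross[of b b' s t] haar_system.cinner_chi[OF hs, of b s t]
      by (cases "b = b'") (simp_all add: chi_def)
    show "S (chi b s) = chi b (s + 1) - chi b 1" if "b \<in> E" "0 \<le> s" for b s
      unfolding chi_def using haar_system.shift_chi[OF hs S _ _ that(2)] that(1)
      by (simp add: f_def e_def)
    show "x \<in> unitary_part \<longleftrightarrow> (\<forall>b\<in>E. \<forall>s\<ge>0. cinner x (chi b s) = 0)" for x
    proof
      assume x: "x \<in> unitary_part"
      then show "\<forall>b\<in>E. \<forall>s\<ge>0. cinner x (chi b s) = 0"
        using orth_iff unitary_part_kernel[OF x Tg] by (simp add: f_def e_def)
    next
      assume x: "\<forall>b\<in>E. \<forall>s\<ge>0. cinner x (chi b s) = 0"
      have xg: "cinner x ((S ^^ n) (g (b, m))) = 0" if b: "b \<in> E" for b m n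
      proof (cases "m = 0")
        case True
        have "cinner x (f b n) = 0" using x orth_iff[OF b] b by blast
        then show ?thesis using True by (simp add: f_def)
      next
        case False
        then obtain j k where m: "m = 2 ^ j + k" "k < 2 ^ j" by (rule heap_index_exists)
        have "cinner x (e b j (n * 2 ^ j + k)) = 0" using x orth_iff[OF b] b by blast
        then show ?thesis using m by (simp add: e_def)
      qed
      show "x \<in> unitary_part"
      proof (rule in_unitary_partI)
        fix n k assume "T k = 0"
        define y where "y = (T ^^ n) x"
        have y: "cinner y v = cinner x ((S ^^ n) v)" for v
          unfolding y_def by (rule cinner_funpow_adjoint[OF adj])
        \<comment> \<open>Orthogonality to the basis vectors extends to the whole kernel.\<close>
        have "K \<subseteq> {v. cinner v y = 0}"
        proof (rule total_set_induct[OF clK K E(1) max])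
          show "E \<subseteq> {v. cinner v y = 0}"
          proof
            fix v assume "v \<in> E"
            then have "v \<in> g ` (E \<times> UNIV)" using bij_betw_imp_surj_on[OF g] by simp
            then obtain b m where "b \<in> E" "v = g (b, m)" by blast
            then have "cinner y v = 0" using xg y by simp
            then show "v \<in> {v. cinner v y = 0}" using cinner_eq_0_commute by blast
          qed
        qed (simp_all add: orthogonal_closed_csubspace)
        then have "cinner k y = 0" using \<open>T k = 0\<close> K_def by blast
        then show "cinner x ((S ^^ n) k) = 0" using y cinner_eq_0_commute by metis
      qed
    qed
  qed
  show ?thesis by (rule embeddable_adjoint)
qed

end

section \<open>Kernels of embeddable operators\<close>

text \<open>If \<open>\<tau>\<close> is the first time at which the orbit of \<open>x\<close> vanishes, then the orbit points before
  \<open>\<tau>\<close> are linearly independent: a suitable \<open>U \<delta>\<close> kills all but the earliest of them.\<close>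

lemma orbit_independent:
  fixes U :: "real \<Rightarrow> 'a::cbanach \<Rightarrow> 'a"
  assumes bc: "\<And>t. 0 \<le> t \<Longrightarrow> bounded_clinear (U t)"
    and U_add: "\<And>s t x. 0 \<le> s \<Longrightarrow> 0 \<le> t \<Longrightarrow> U s (U t x) = U (s + t) x"
    and nz: "\<And>t. 0 \<le> t \<Longrightarrow> t < \<tau> \<Longrightarrow> U t x \<noteq> 0" and z: "\<And>t. \<tau> \<le> t \<Longrightarrow> U t x = 0"
    and Q: "finite Q" "Q \<subseteq> {0..<\<tau>}" and sum: "(\<Sum>s\<in>Q. c s *\<^sub>C U s x) = 0" and s: "s \<in> Q"
  shows "c s = 0"
proof (rule ccontr)
  assume "c s \<noteq> 0"
  define P where "P = {s \<in> Q. c s \<noteq> 0}"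
  have P: "finite P" "P \<noteq> {}" using Q s \<open>c s \<noteq> 0\<close> by (auto simp: P_def)
  define s1 where "s1 = Min P"
  have s1: "s1 \<in> P" using P by (simp add: s1_def)
  \<comment> \<open>The second smallest index that occurs, or \<open>\<tau>\<close> if there is
    none.\<close>
  define s2 where "s2 = Min (insert \<tau> (P - {s1}))"
  have "s2 \<in> insert \<tau> (P - {s1})" unfolding s2_def by (rule Min_in) (use P in auto)
  moreover have "s1 \<le> r" if "r \<in> P" for r using that P by (simp add: s1_def)
  ultimately have s12: "s1 < s2" using s1 Q(2) by (fastforce simp: P_def)
  have s2_le: "s2 \<le> r" if "r \<in> insert \<tau> (P - {s1})" for r
    unfolding s2_def by (rule Min_le) (use P that in auto)
  \<comment> \<open>The shift that carries \<open>s2\<close>, and hence all later indices, to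
    \<open>\<tau>\<close> or beyond, while \<open>s1\<close> stays before
    \<open>\<tau>\<close>.\<close>
  define \<delta> where "\<delta> = \<tau> - s2"
  have \<delta>: "0 \<le> \<delta>" using s2_le[of \<tau>] by (simp add: \<delta>_def)
  have "0 \<le> s1" "s1 \<in> Q" "c s1 \<noteq> 0" using s1 Q(2) by (auto simp: P_def)
  have "0 = U \<delta> (\<Sum>s\<in>Q. c s *\<^sub>C U s x)" using bc[OF \<delta>] by (simp add: sum bounded_clinear_zero)
  also have "\<dots> = (\<Sum>s\<in>Q. U \<delta> (c s *\<^sub>C U s x))"
    by (rule linear_sum[OF bounded_linear.linear[OF bounded_clinear_imp[OF bc[OF \<delta>]]]])
  also have "\<dots> = (\<Sum>r\<in>Q. if r = s1 then c s1 *\<^sub>C U (\<delta> + s1) x else 0)"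
  proof (rule sum.cong)
    fix r assume r: "r \<in> Q"
    then have r0: "0 \<le> r" using Q(2) by auto
    have eq: "U \<delta> (c r *\<^sub>C U r x) = c r *\<^sub>C U (\<delta> + r) x"
      using bc[OF \<delta>] U_add[OF \<delta> r0] by (simp add: bounded_clinear_scaleC)
    show "U \<delta> (c r *\<^sub>C U r x) = (if r = s1 then c s1 *\<^sub>C U (\<delta> + s1) x else 0)"
    proof (cases "r = s1 \<or> c r = 0")
      case False
      then have "s2 \<le> r" using r by (intro s2_le) (auto simp: P_def)
      then have "U (\<delta> + r) x = 0" by (intro z) (simp add: \<delta>_def)
      then show ?thesis using False eq by simp
    qed (use eq in auto)
  qed simp
  also have "\<dots> = c s1 *\<^sub>C U (\<delta> + s1) x" using Q(1) \<open>s1 \<in> Q\<close> by simp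
  finally have "U (\<delta> + s1) x = 0" using \<open>c s1 \<noteq> 0\<close> by simp
  moreover have "U (\<delta> + s1) x \<noteq> 0" using \<delta> \<open>0 \<le> s1\<close> s12 by (intro nz) (auto simp: \<delta>_def)
  ultimately show False by blast
qed

text \<open>\<open>T = U 1\<close> commutes with the semigroup, so the orbit of \<open>x\<close>
  stays in the kernel. By continuity and \<open>U 0 = id\<close> it first vanishes at a positive
  time, which leaves infinitely many independent orbit points.\<close>

lemma embeddable_kernel:
  fixes T :: "'a::cbanach \<Rightarrow> 'a"
  assumes emb: "embeddable T" and ker: "T x = 0" "x \<noteq> 0"
  shows "\<not> finite_cdim {x. T x = 0}"
proof
  assume "finite_cdim {x. T x = 0}"
  then obtain B where B: "finite B" "cspan B = {x. T x = 0}" unfolding finite_cdim_def by blast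
  from emb obtain U where U: "C0_semigroup U" "T = U 1" unfolding embeddable_def by blast
  have bc: "\<And>t. 0 \<le> t \<Longrightarrow> bounded_clinear (U t)" and U0: "U 0 = id"
    and U_comp: "\<And>s t. 0 \<le> s \<Longrightarrow> 0 \<le> t \<Longrightarrow> U (s + t) = U s \<circ> U t"
    and cont: "continuous_on {0..} (\<lambda>t. U t x)"
    using U(1) unfolding C0_semigroup_def by blast+
  have U_add: "U s (U t y) = U (s + t) y" if "0 \<le> s" "0 \<le> t" for s t y
    using U_comp[OF that] by simp
  define Z where "Z = {t \<in> {0..}. U t x = 0}"
  define \<tau> where "\<tau> = Inf Z"
  have "closed Z" unfolding Z_def by (rule continuous_closed_preimage_constant[OF cont]) simp
  moreover have "1 \<in> Z" using ker U(2) by (simp add: Z_def)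
  moreover have bdd: "bdd_below Z" by (rule bdd_belowI[of _ 0]) (simp add: Z_def)
  ultimately have "\<tau> \<in> Z" unfolding \<tau>_def by (intro closed_contains_Inf) auto
  then have \<tau>: "0 \<le> \<tau>" "U \<tau> x = 0" by (auto simp: Z_def)
  have "\<tau> \<noteq> 0" using \<tau>(2) U0 ker by auto
  have nz: "U t x \<noteq> 0" if "0 \<le> t" "t < \<tau>" for t
    using cInf_lower[OF _ bdd, of t] that unfolding \<tau>_def Z_def by force
  have z: "U t x = 0" if "\<tau> \<le> t" for t
    using U_add[of "t - \<tau>" \<tau> x] that \<tau> bc[of "t - \<tau>"] by (simp add: bounded_clinear_zero)
  have inj: "inj_on (\<lambda>s. U s x) {0..<\<tau>}"
  proof (rule linorder_inj_onI)
    fix s t assume st: "s < t" "s \<in> {0..<\<tau>}" "t \<in> {0..<\<tau>}"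
    show "U s x \<noteq> U t x"
    proof
      assume "U s x = U t x"
      \<comment> \<open>A coincidence at \<open>s < t\<close>, moved on by
        \<open>\<tau> - t\<close>, would make the orbit vanish before \<open>\<tau>\<close>.\<close>
      then have "U (\<tau> - t + s) x = U (\<tau> - t + t) x" using st U_add[of "\<tau> - t" s x] U_add[of "\<tau> - t" t x] by simp
      moreover have "U (\<tau> - t + s) x \<noteq> 0" using st by (intro nz) auto
      ultimately show False using \<tau> by simp
    qed
  qed auto
  have "infinite {0..<\<tau>}" using \<tau>(1) \<open>\<tau> \<noteq> 0\<close> by simp
  then obtain Q where Q: "finite Q" "card Q = Suc (card B)" "Q \<subseteq> {0..<\<tau>}"
    using infinite_arbitrarily_large by blast
  define A where "A = (\<lambda>s. U s x) ` Q"
  have injQ: "inj_on (\<lambda>s. U s x) Q" using inj Q(3) inj_on_subset by blast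
  have "complex_vector.independent A"
  proof (rule complex_vector.independent_if_scalars_zero)
    fix c v assume sum: "(\<Sum>v\<in>A. c v *\<^sub>C v) = 0" and v: "v \<in> A"
    then obtain s where s: "s \<in> Q" "v = U s x" unfolding A_def by blast
    have "(\<Sum>s\<in>Q. c (U s x) *\<^sub>C U s x) = 0"
      using sum unfolding A_def by (simp add: sum.reindex[OF injQ])
    from orbit_independent[OF bc U_add nz z Q(1,3) this s(1)] show "c v = 0" using s(2) by simp
  qed (simp add: A_def Q)
  moreover have "A \<subseteq> cspan B"
  proof
    fix v assume "v \<in> A"
    then obtain s where s: "s \<in> Q" "v = U s x" unfolding A_def by blast
    have s0: "0 \<le> s" using s(1) Q(3) by auto
    have "T v = U s (U 1 x)" using U_add[of 1 s x] U_add[of s 1 x] s0 s(2) U(2) by (simp add: add.commute)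
    then have "T v = 0" using ker U(2) bc[OF s0] by (simp add: bounded_clinear_zero)
    then show "v \<in> cspan B" using B(2) by blast
  qed
  ultimately have "card A \<le> card B" using complex_vector.independent_span_bound[OF B(1)] by blast
  then show False using card_image[OF injQ] Q(2) by (simp add: A_def)
qed

theorem corollary4p5:
  fixes T :: "'a::chilbert_space \<Rightarrow> 'a"
  assumes "bounded_clinear T"
    and "isometry (cadjoint T)"
  shows "embeddable T \<longleftrightarrow> inj T \<or> \<not> finite_cdim {x. T x = 0}"
proof -
  define S where "S = cadjoint T"
  have adj: "cinner (T x) y = cinner x (S y)" for x y
    using someI_ex[OF adjoint_exists[OF assms(1)]] unfolding S_def cadjoint_def by blast
  have S: "bounded_clinear S"
    by (rule adjoint_bounded_clinear[OF bounded_clinear_imp[OF assms(1)] adj])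
  \<comment> \<open>The isometry hypothesis is metric; as \<open>S\<close> is linear, comparison
    with 0 makes it a statement about norms.\<close>
  have "dist (S x) (S 0) = dist x 0" for x
    using assms(2) unfolding isometry_def S_def by blast
  then have "norm (S x) = norm x" for x using S by (simp add: bounded_clinear_zero)
  then interpret isometry_adjoint S T
    using S assms(1) adj by unfold_locales
  have inj: "inj T \<longleftrightarrow> (\<forall>k. T k = 0 \<longrightarrow> k = 0)"
    using linear_injective_0[OF bounded_linear.linear[OF bounded_clinear_imp[OF assms(1)]]] by blast
  show ?thesis
    using embeddable_kernel[of T] embeddable_if_injective embeddable_if_infinite_kernel inj by blast
qed

end
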